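(* For a linear map $P:\mathcal{M}_2\to\mathcal{M}_2$ the following are equivalent: (1) $P\otimes P:\mathcal{M}_2\otimes\mathcal{M}_2\to\mathcal{M}_2\otimes\mathcal{M}_2$ is positive; (2) $P\otimes P$ is decomposable.
   Context: $\mathcal{M}_d$ denotes the complex $d\times d$ matrices. A linear map $L:\mathcal{M}_{d_1}\to\mathcal{M}_{d_2}$ is positive if it maps positive semidefinite matrices to positive semidefinite matrices, completely positive if $\mathrm{id}_k\otimes L$ is positive for all $k\in\mathbb{N}$, and decomposable if $L=T+\vartheta_{d_2}\circ S$ for completely positive maps $T,S:\mathcal{M}_{d_1}\to\mathcal{M}_{d_2}$, where $\vartheta_{d}(X)=X^T$ is the transpose in the computational basis. *)

theory Defs
  imports Complex_Main "Jordan_Normal_Form.Matrix"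
begin

text \<open>Matrices in M_d are complex d x d matrices (carrier_mat d d).
  The tensor product M_a \<otimes> M_b is identified with M_(a*b) via the Kronecker
  (computational basis) ordering: index (i,k) \<mapsto> i*b + k.\<close>

definition psd :: "nat \<Rightarrow> complex mat \<Rightarrow> bool" where
  "psd n A \<longleftrightarrow> A \<in> carrier_mat n n
     \<and> (\<forall>i<n. \<forall>j<n. A $$ (i,j) = cnj (A $$ (j,i)))
     \<and> (\<forall>v :: nat \<Rightarrow> complex.
          Im (\<Sum>i<n. \<Sum>j<n. cnj (v i) * A $$ (i,j) * v j) = 0
        \<and> Re (\<Sum>i<n. \<Sum>j<n. cnj (v i) * A $$ (i,j) * v j) \<ge> 0)"

definition lin_map :: "nat \<Rightarrow> nat \<Rightarrow> (complex mat \<Rightarrow> complex mat) \<Rightarrow> bool" where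
  "lin_map d1 d2 L \<longleftrightarrow>
     (\<forall>A \<in> carrier_mat d1 d1. L A \<in> carrier_mat d2 d2)
   \<and> (\<forall>A \<in> carrier_mat d1 d1. \<forall>B \<in> carrier_mat d1 d1. L (A + B) = L A + L B)
   \<and> (\<forall>c. \<forall>A \<in> carrier_mat d1 d1. L (c \<cdot>\<^sub>m A) = c \<cdot>\<^sub>m L A)"

definition positive_map :: "nat \<Rightarrow> nat \<Rightarrow> (complex mat \<Rightarrow> complex mat) \<Rightarrow> bool" where
  "positive_map d1 d2 L \<longleftrightarrow> (\<forall>A. psd d1 A \<longrightarrow> psd d2 (L A))"

definition blk :: "nat \<Rightarrow> complex mat \<Rightarrow> nat \<Rightarrow> nat \<Rightarrow> complex mat" where
  "blk d X a b = mat d d (\<lambda>(i,j). X $$ (a*d + i, b*d + j))"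

definition ampl :: "nat \<Rightarrow> nat \<Rightarrow> nat \<Rightarrow> (complex mat \<Rightarrow> complex mat) \<Rightarrow> complex mat \<Rightarrow> complex mat" where
  "ampl k d1 d2 L X = mat (k*d2) (k*d2)
     (\<lambda>(r,s). L (blk d1 X (r div d2) (s div d2)) $$ (r mod d2, s mod d2))"

definition completely_positive :: "nat \<Rightarrow> nat \<Rightarrow> (complex mat \<Rightarrow> complex mat) \<Rightarrow> bool" where
  "completely_positive d1 d2 L \<longleftrightarrow> lin_map d1 d2 L \<and> (\<forall>k. positive_map (k*d1) (k*d2) (ampl k d1 d2 L))"

definition decomposable :: "nat \<Rightarrow> nat \<Rightarrow> (complex mat \<Rightarrow> complex mat) \<Rightarrow> bool" where
  "decomposable d1 d2 L \<longleftrightarrow> (\<exists>T S. completely_positive d1 d2 T \<and> completely_positive d1 d2 S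
     \<and> (\<forall>X \<in> carrier_mat d1 d1. L X = T X + transpose_mat (S X)))"

definition unit_mat :: "nat \<Rightarrow> nat \<Rightarrow> nat \<Rightarrow> complex mat" where
  "unit_mat d a b = mat d d (\<lambda>(i,j). if i = a \<and> j = b then 1 else 0)"

text \<open>P \<otimes> Q : M_a \<otimes> M_b \<rightarrow> M_c \<otimes> M_e, defined by linear extension:
  (P \<otimes> Q)(X) = \<Sum>_{i,j<a} P(E_ij) \<otimes> Q(X_ij) where X = \<Sum> E_ij \<otimes> X_ij.\<close>
definition tensor_map :: "nat \<Rightarrow> nat \<Rightarrow> nat \<Rightarrow> nat \<Rightarrow> (complex mat \<Rightarrow> complex mat)
    \<Rightarrow> (complex mat \<Rightarrow> complex mat) \<Rightarrow> complex mat \<Rightarrow> complex mat" where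
  "tensor_map a b c e P Q X = mat (c*e) (c*e) (\<lambda>(r,s).
     \<Sum>i<a. \<Sum>j<a. P (unit_mat a i j) $$ (r div e, s div e) * Q (blk b X i j) $$ (r mod e, s mod e))"

end

theory Submission
  imports Defs "HOL-Analysis.Analysis"
begin

text \<open>Decomposable maps are always positive. Conversely, if \<open>P \<otimes> P\<close> is positive then \<open>P\<close> or \<open>- P\<close>
  is positive, and since decomposability is a closed condition (bounded families of Kraus operators
  have convergent subsequences) \<open>P\<close> may be replaced by \<open>P + \<epsilon> tr(\<cdot>) I\<close>. A strictly positive \<open>P\<close>
  becomes Pauli diagonal, \<open>X \<mapsto> \<Sum>\<^sub>n q\<^sub>n \<sigma>\<^sub>n X \<sigma>\<^sub>n\<close>, after conjugating input and output by elements of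
  \<open>SL(2,\<complex>)\<close>: minimise a weighted sum \<open>\<Sum>\<^sub>m \<omega>\<^sub>m tr(\<sigma>\<^sub>m A* P(B \<sigma>\<^sub>m B*) A)\<close> over \<open>SL(2,\<complex>) \<times> SL(2,\<complex>)\<close>;
  as the weights have distinct squares, stationarity annihilates all off-diagonal entries.
  Evaluating \<open>P \<otimes> P\<close> on maximally entangled vectors yields \<open>q\<^sub>a q\<^sub>b + q\<^sub>c q\<^sub>d \<ge> 0\<close> for every
  enumeration \<open>a, b, c, d\<close> of the indices. Since the map \<open>X \<mapsto> tr(X) I - X\<close> is the transposition up to
  a unitary conjugation and acts on the coefficients \<open>q\<close> by a reflection \<open>R\<close>, it remains to write the matrix
  \<open>q q\<^sup>T\<close> as \<open>p\<^sub>1 + R p\<^sub>2 R\<close> with entrywise nonnegative \<open>p\<^sub>1, p\<^sub>2\<close>.\<close>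

no_notation vec_index (infixl "$" 100)

section \<open>Maps in Kraus form\<close>

definition kraus_map :: "nat \<Rightarrow> nat \<Rightarrow> (nat \<Rightarrow> nat \<Rightarrow> nat \<Rightarrow> complex) \<Rightarrow> complex mat \<Rightarrow> complex mat" where
  "kraus_map d N K X = Matrix.mat d d (\<lambda>(r,s). \<Sum>\<kappa><N. \<Sum>p<d. \<Sum>q<d. K \<kappa> r p * X $$ (p,q) * cnj (K \<kappa> s q))"

lemma sum_swap3:
  "(\<Sum>i\<in>A. \<Sum>j\<in>B. \<Sum>k\<in>C. f i j k) = (\<Sum>k\<in>C. \<Sum>i\<in>A. \<Sum>j\<in>B. f i j k)"
proof -
  have "(\<Sum>i\<in>A. \<Sum>j\<in>B. \<Sum>k\<in>C. f i j k) = (\<Sum>i\<in>A. \<Sum>k\<in>C. \<Sum>j\<in>B. f i j k)"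
    by (intro sum.cong refl sum.swap)
  also have "\<dots> = (\<Sum>k\<in>C. \<Sum>i\<in>A. \<Sum>j\<in>B. f i j k)" by (rule sum.swap)
  finally show ?thesis .
qed

text \<open>The quadratic form of \<open>B\<close> at \<open>v\<close> is the sum over \<kappa> of
  the forms of \<open>A\<close> at the adjoint of \<open>M \<kappa>\<close> applied to
  \<open>v\<close>. The sizes \<open>m\<close> and \<open>n\<close> may differ, so this serves
  amplified maps and, with \<open>m = 1\<close>, rank-one matrices.\<close>

lemma psd_kraus:
  assumes A: "psd m A" and B: "B \<in> carrier_mat n n"
    and eq: "\<And>r s. r < n \<Longrightarrow> s < n \<Longrightarrow>
      B $$ (r,s) = (\<Sum>\<kappa><N::nat. \<Sum>p<m. \<Sum>q<m. M \<kappa> r p * A $$ (p,q) * cnj (M \<kappa> s q))"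
  shows "psd n B"
  unfolding psd_def
proof (intro conjI allI impI)
  show "B \<in> carrier_mat n n" by fact
next
  fix i j assume ij: "i < n" "j < n"
  have herm: "A $$ (p,q) = cnj (A $$ (q,p))" if "p < m" "q < m" for p q
    using A that unfolding psd_def by blast
  have "cnj (B $$ (j,i)) = (\<Sum>\<kappa><N. \<Sum>p<m. \<Sum>q<m. cnj (M \<kappa> j p) * cnj (A $$ (p,q)) * M \<kappa> i q)"
    using ij by (simp add: eq)
  also have "\<dots> = (\<Sum>\<kappa><N. \<Sum>q<m. \<Sum>p<m. cnj (M \<kappa> j p) * cnj (A $$ (p,q)) * M \<kappa> i q)"
    by (intro sum.cong refl sum.swap)
  also have "\<dots> = B $$ (i,j)"
    unfolding eq[OF ij] by (intro sum.cong refl) (metis (no_types, lifting) herm lessThan_iff mult.assoc mult.commute)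
  finally show "B $$ (i,j) = cnj (B $$ (j,i))" ..
next
  fix v :: "nat \<Rightarrow> complex"
  define w where "w \<kappa> p = (\<Sum>r<n. cnj (M \<kappa> r p) * v r)" for \<kappa> p
  let ?S = "\<Sum>i<n. \<Sum>j<n. cnj (v i) * B $$ (i, j) * v j"
  have "?S = (\<Sum>i<n. \<Sum>j<n. \<Sum>\<kappa><N. \<Sum>p<m. \<Sum>q<m. cnj (v i) * (M \<kappa> i p * A $$ (p,q) * cnj (M \<kappa> j q)) * v j)"
    by (intro sum.cong refl) (simp add: eq sum_distrib_left sum_distrib_right)
  also have "\<dots> = (\<Sum>\<kappa><N. \<Sum>i<n. \<Sum>j<n. \<Sum>p<m. \<Sum>q<m. cnj (v i) * (M \<kappa> i p * A $$ (p,q) * cnj (M \<kappa> j q)) * v j)"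
    by (rule sum_swap3)
  also have "\<dots> = (\<Sum>\<kappa><N. \<Sum>p<m. \<Sum>q<m. \<Sum>i<n. \<Sum>j<n. cnj (v i) * (M \<kappa> i p * A $$ (p,q) * cnj (M \<kappa> j q)) * v j)"
  proof (rule sum.cong[OF refl])
    fix \<kappa>
    let ?f = "\<lambda>i j p q. cnj (v i) * (M \<kappa> i p * A $$ (p,q) * cnj (M \<kappa> j q)) * v j"
    have "(\<Sum>i<n. \<Sum>j<n. \<Sum>p<m. \<Sum>q<m. ?f i j p q) = (\<Sum>i<n. \<Sum>p<m. \<Sum>j<n. \<Sum>q<m. ?f i j p q)"
      by (intro sum.cong refl sum.swap)
    also have "\<dots> = (\<Sum>p<m. \<Sum>i<n. \<Sum>j<n. \<Sum>q<m. ?f i j p q)" by (rule sum.swap)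
    also have "\<dots> = (\<Sum>p<m. \<Sum>i<n. \<Sum>q<m. \<Sum>j<n. ?f i j p q)"
      by (intro sum.cong refl sum.swap)
    also have "\<dots> = (\<Sum>p<m. \<Sum>q<m. \<Sum>i<n. \<Sum>j<n. ?f i j p q)"
      by (intro sum.cong refl sum.swap)
    finally show "(\<Sum>i<n. \<Sum>j<n. \<Sum>p<m. \<Sum>q<m. ?f i j p q) = (\<Sum>p<m. \<Sum>q<m. \<Sum>i<n. \<Sum>j<n. ?f i j p q)" .
  qed
  also have "\<dots> = (\<Sum>\<kappa><N. \<Sum>p<m. \<Sum>q<m. cnj (w \<kappa> p) * A $$ (p,q) * w \<kappa> q)"
  proof (intro sum.cong refl)
    fix \<kappa> p q
    have "cnj (w \<kappa> p) * A $$ (p,q) * w \<kappa> q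
      = A $$ (p,q) * ((\<Sum>i<n. M \<kappa> i p * cnj (v i)) * (\<Sum>j<n. cnj (M \<kappa> j q) * v j))"
      by (simp add: w_def)
    also have "\<dots> = (\<Sum>i<n. \<Sum>j<n. A $$ (p,q) * (M \<kappa> i p * cnj (v i) * (cnj (M \<kappa> j q) * v j)))"
      unfolding sum_product by (simp only: sum_distrib_left)
    finally show "(\<Sum>i<n. \<Sum>j<n. cnj (v i) * (M \<kappa> i p * A $$ (p,q) * cnj (M \<kappa> j q)) * v j)
      = cnj (w \<kappa> p) * A $$ (p,q) * w \<kappa> q"
      by (simp add: mult_ac)
  qed
  finally have S: "?S = (\<Sum>\<kappa><N. \<Sum>p<m. \<Sum>q<m. cnj (w \<kappa> p) * A $$ (p,q) * w \<kappa> q)" .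
  have pos: "Im (\<Sum>p<m. \<Sum>q<m. cnj (w \<kappa> p) * A $$ (p,q) * w \<kappa> q) = 0
      \<and> Re (\<Sum>p<m. \<Sum>q<m. cnj (w \<kappa> p) * A $$ (p,q) * w \<kappa> q) \<ge> 0" for \<kappa>
    using A unfolding psd_def by blast
  show "Im ?S = 0" unfolding S Im_sum[of _ "{..<N}"] using pos by (intro sum.neutral) auto
  show "Re ?S \<ge> 0" unfolding S Re_sum[of _ "{..<N}"] using pos by (intro sum_nonneg) auto
qed

lemma sum_mult_nat: "(\<Sum>r<k*d. f r) = (\<Sum>a<k. \<Sum>i<d. f (a*d+i))" for f :: "nat \<Rightarrow> 'a::comm_monoid_add"
proof (induction k)
  case (Suc k)
  have "(\<Sum>r<Suc k*d. f r) = sum f {0..<k*d} + sum f {k*d..<k*d+d}"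
    by (simp add: lessThan_atLeast0 add.commute[of d] sum.atLeastLessThan_concat)
  also have "sum f {k*d..<k*d+d} = (\<Sum>i<d. f (k*d+i))"
    using sum.shift_bounds_nat_ivl[of f 0 "k*d" d] by (simp add: lessThan_atLeast0 add.commute)
  finally have "(\<Sum>r<Suc k*d. f r) = sum f {..<k*d} + (\<Sum>i<d. f (k*d+i))"
    by (simp add: lessThan_atLeast0)
  then show ?case using Suc by simp
qed simp

lemma kraus_completely_positive: "completely_positive d d (kraus_map d N K)"
  unfolding completely_positive_def
proof (intro conjI allI)
  show "lin_map d d (kraus_map d N K)"
    unfolding lin_map_def
  proof (intro conjI ballI allI)
    fix A B :: "complex mat" assume "A \<in> carrier_mat d d" "B \<in> carrier_mat d d"
    then show "kraus_map d N K (A + B) = kraus_map d N K A + kraus_map d N K B"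
      by (intro eq_matI) (auto simp: kraus_map_def algebra_simps sum.distrib)
  next
    fix c and A :: "complex mat" assume "A \<in> carrier_mat d d"
    then show "kraus_map d N K (c \<cdot>\<^sub>m A) = c \<cdot>\<^sub>m kraus_map d N K A"
      by (intro eq_matI) (auto simp: kraus_map_def algebra_simps sum_distrib_left intro!: sum.cong)
  qed (simp add: kraus_map_def)
next
  fix k
  show "positive_map (k*d) (k*d) (ampl k d d (kraus_map d N K))"
    unfolding positive_map_def
  proof (intro allI impI)
    fix A assume A: "psd (k*d) A"
    \<comment> \<open>\<open>M \<kappa>\<close> is the Kronecker product of the identity of size
      \<open>k\<close> with \<open>K \<kappa>\<close>; the amplification is again in Kraus
      form.\<close>
    define M where "M \<kappa> r p = (if r div d = p div d then K \<kappa> (r mod d) (p mod d) else 0)" for \<kappa> r p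
    show "psd (k*d) (ampl k d d (kraus_map d N K) A)"
    proof (rule psd_kraus[OF A, where N = N and M = M])
      fix r s assume rs: "r < k*d" "s < k*d"
      then have d: "d > 0" by (cases d) auto
      have a: "r div d < k" "s div d < k" using rs by (auto simp: less_mult_imp_div_less)
      have "(\<Sum>\<kappa><N. \<Sum>p<k*d. \<Sum>q<k*d. M \<kappa> r p * A $$ (p,q) * cnj (M \<kappa> s q))
        = (\<Sum>\<kappa><N. \<Sum>a<k. \<Sum>p<d. \<Sum>b<k. \<Sum>q<d. M \<kappa> r (a*d+p) * A $$ (a*d+p,b*d+q) * cnj (M \<kappa> s (b*d+q)))"
        by (simp add: sum_mult_nat)
      also have "\<dots> = (\<Sum>\<kappa><N. \<Sum>a<k. \<Sum>p<d. \<Sum>b<k. \<Sum>q<d. if b = s div d then (if a = r div d then 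
          K \<kappa> (r mod d) p * A $$ (a*d+p,b*d+q) * cnj (K \<kappa> (s mod d) q) else 0) else 0)"
        by (intro sum.cong refl) (auto simp: M_def)
      also have "\<dots> = (\<Sum>\<kappa><N. \<Sum>a<k. \<Sum>p<d. \<Sum>b<k. if b = s div d then (\<Sum>q<d. if a = r div d then 
          K \<kappa> (r mod d) p * A $$ (a*d+p,b*d+q) * cnj (K \<kappa> (s mod d) q) else 0) else 0)"
        by (intro sum.cong refl) auto
      also have "\<dots> = (\<Sum>\<kappa><N. \<Sum>a<k. if a = r div d then (\<Sum>p<d. \<Sum>q<d.
          K \<kappa> (r mod d) p * A $$ (a*d+p,(s div d)*d+q) * cnj (K \<kappa> (s mod d) q)) else 0)"
        using a by (intro sum.cong refl) (auto simp: sum.delta)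
      also have "\<dots> = ampl k d d (kraus_map d N K) A $$ (r,s)"
        using a rs d by (simp add: sum.delta ampl_def kraus_map_def blk_def)
      finally show "ampl k d d (kraus_map d N K) A $$ (r,s) = (\<Sum>\<kappa><N. \<Sum>p<k*d. \<Sum>q<k*d. M \<kappa> r p * A $$ (p,q) * cnj (M \<kappa> s q))" ..
    qed (simp add: ampl_def)
  qed
qed

section \<open>Positivity of decomposable maps\<close>

lemma psd_add: "psd n A \<Longrightarrow> psd n B \<Longrightarrow> psd n (A + B)"
proof -
  assume assms: "psd n A" "psd n B"
  have A: "A \<in> carrier_mat n n" and hA: "\<And>i j. i < n \<Longrightarrow> j < n \<Longrightarrow> A $$ (i,j) = cnj (A $$ (j,i))"
    and B: "B \<in> carrier_mat n n" and hB: "\<And>i j. i < n \<Longrightarrow> j < n \<Longrightarrow> B $$ (i,j) = cnj (B $$ (j,i))"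
    using assms unfolding psd_def by blast+
  show ?thesis
    unfolding psd_def
  proof (intro conjI allI impI)
    show "A + B \<in> carrier_mat n n" using A B by simp
  next
    fix i j assume ij: "i < n" "j < n"
    then have "(A + B) $$ (i,j) = A $$ (i,j) + B $$ (i,j)" "(A + B) $$ (j,i) = A $$ (j,i) + B $$ (j,i)"
      using A B by simp_all
    then show "(A + B) $$ (i,j) = cnj ((A + B) $$ (j,i))"
      using hA[OF ij] hB[OF ij] by simp
  next
    fix v :: "nat \<Rightarrow> complex"
    have "(\<Sum>i<n. \<Sum>j<n. cnj (v i) * (A + B) $$ (i,j) * v j)
      = (\<Sum>i<n. \<Sum>j<n. cnj (v i) * A $$ (i,j) * v j + cnj (v i) * B $$ (i,j) * v j)"
      using A B by (intro sum.cong refl) (simp add: algebra_simps)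
    then have eq: "(\<Sum>i<n. \<Sum>j<n. cnj (v i) * (A + B) $$ (i,j) * v j)
      = (\<Sum>i<n. \<Sum>j<n. cnj (v i) * A $$ (i,j) * v j) + (\<Sum>i<n. \<Sum>j<n. cnj (v i) * B $$ (i,j) * v j)"
      by (simp add: sum.distrib)
    have "Im (\<Sum>i<n. \<Sum>j<n. cnj (v i) * X $$ (i,j) * v j) = 0
        \<and> Re (\<Sum>i<n. \<Sum>j<n. cnj (v i) * X $$ (i,j) * v j) \<ge> 0" if "psd n X" for X
      using that unfolding psd_def by blast
    from this[OF assms(1)] this[OF assms(2)]
    show "Im (\<Sum>i<n. \<Sum>j<n. cnj (v i) * (A + B) $$ (i,j) * v j) = 0"
      and "0 \<le> Re (\<Sum>i<n. \<Sum>j<n. cnj (v i) * (A + B) $$ (i,j) * v j)"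
      unfolding eq by auto
  qed
qed

lemma psd_transpose:
  assumes "psd n A" shows "psd n (transpose_mat A)"
proof -
  have A: "A \<in> carrier_mat n n" and herm: "\<And>i j. i < n \<Longrightarrow> j < n \<Longrightarrow> A $$ (j,i) = cnj (A $$ (i,j))"
    and form: "\<And>v. Im (\<Sum>i<n. \<Sum>j<n. cnj (v i) * A $$ (i,j) * v j) = 0
      \<and> Re (\<Sum>i<n. \<Sum>j<n. cnj (v i) * A $$ (i,j) * v j) \<ge> 0"
    using assms unfolding psd_def by blast+
  show ?thesis
    unfolding psd_def
  proof (intro conjI allI impI)
    show "transpose_mat A \<in> carrier_mat n n" using A by simp
  next
    fix i j assume ij: "i < n" "j < n"
    then have "transpose_mat A $$ (i,j) = A $$ (j,i)" "transpose_mat A $$ (j,i) = A $$ (i,j)"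
      using A by simp_all
    then show "transpose_mat A $$ (i,j) = cnj (transpose_mat A $$ (j,i))"
      using herm[OF ij] by simp
  next
    fix v :: "nat \<Rightarrow> complex"
    have "(\<Sum>i<n. \<Sum>j<n. cnj (v i) * transpose_mat A $$ (i, j) * v j) = (\<Sum>i<n. \<Sum>j<n. cnj (v i) * A $$ (j,i) * v j)"
      using A by (intro sum.cong refl) simp
    also have "\<dots> = (\<Sum>j<n. \<Sum>i<n. cnj (cnj (v j)) * A $$ (j,i) * cnj (v i))"
      by (subst sum.swap) (simp add: mult_ac)
    finally have eq: "(\<Sum>i<n. \<Sum>j<n. cnj (v i) * transpose_mat A $$ (i, j) * v j) = (\<Sum>j<n. \<Sum>i<n. cnj (cnj (v j)) * A $$ (j,i) * cnj (v i))" .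
    have "Im (\<Sum>j<n. \<Sum>i<n. cnj (cnj (v j)) * A $$ (j,i) * cnj (v i)) = 0
        \<and> Re (\<Sum>j<n. \<Sum>i<n. cnj (cnj (v j)) * A $$ (j,i) * cnj (v i)) \<ge> 0"
      using form[of "\<lambda>j. cnj (v j)"] .
    then show "Im (\<Sum>i<n. \<Sum>j<n. cnj (v i) * transpose_mat A $$ (i, j) * v j) = 0"
      and "0 \<le> Re (\<Sum>i<n. \<Sum>j<n. cnj (v i) * transpose_mat A $$ (i, j) * v j)"
      unfolding eq by auto
  qed
qed

text \<open>The amplification with \<open>k = 1\<close> is the map itself.\<close>

lemma completely_positive_imp_positive:
  assumes "completely_positive d1 d2 T" shows "positive_map d1 d2 T"
  unfolding positive_map_def
proof (intro allI impI)
  fix A assume A: "psd d1 A"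
  have "A \<in> carrier_mat d1 d1" using A unfolding psd_def by blast
  moreover from this have "blk d1 A 0 0 = A"
    by (intro eq_matI) (auto simp: blk_def)
  moreover have "T A \<in> carrier_mat d2 d2"
    using assms calculation unfolding completely_positive_def lin_map_def by blast
  ultimately have "ampl 1 d1 d2 T A = T A"
    by (intro eq_matI) (auto simp: ampl_def)
  moreover have "psd (1*d2) (ampl 1 d1 d2 T A)"
    using assms A unfolding completely_positive_def positive_map_def by (metis mult_1)
  ultimately show "psd d2 (T A)" by simp
qed

lemma decomposable_imp_positive:
  assumes "decomposable d1 d2 L" shows "positive_map d1 d2 L"
proof -
  obtain T S where TS: "completely_positive d1 d2 T" "completely_positive d1 d2 S"
    and L: "\<And>X. X \<in> carrier_mat d1 d1 \<Longrightarrow> L X = T X + transpose_mat (S X)"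
    using assms unfolding decomposable_def by blast
  show ?thesis
    unfolding positive_map_def
  proof (intro allI impI)
    fix A assume A: "psd d1 A"
    then have "L A = T A + transpose_mat (S A)" using L unfolding psd_def by blast
    then show "psd d2 (L A)"
      using A TS[THEN completely_positive_imp_positive] psd_add psd_transpose
      unfolding positive_map_def by metis
  qed
qed

text \<open>\<open>C p q r s\<close> is the \<open>(r,s)\<close> entry of the image of the matrix unit \<open>E_pq\<close>. The \<open>L\<close> terms describe a
  completely positive map followed by the transposition, hence the exchange of \<open>r\<close> and \<open>s\<close>.\<close>

definition kraus_decomposition :: "nat \<Rightarrow> nat \<Rightarrow> (nat \<Rightarrow> nat \<Rightarrow> nat \<Rightarrow> nat \<Rightarrow> complex) \<Rightarrow> bool" where
  "kraus_decomposition d N C \<longleftrightarrow> (\<exists>K L. \<forall>p<d. \<forall>q<d. \<forall>r<d. \<forall>s<d. C p q r s =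
     (\<Sum>\<kappa><N. K \<kappa> r p * cnj (K \<kappa> s q) + L \<kappa> s p * cnj (L \<kappa> r q)))"

lemma kraus_decomposition_imp_decomposable:
  assumes "kraus_decomposition d N C"
    and car: "\<And>X. X \<in> carrier_mat d d \<Longrightarrow> \<Phi> X \<in> carrier_mat d d"
    and entry: "\<And>X r s. X \<in> carrier_mat d d \<Longrightarrow> r < d \<Longrightarrow> s < d \<Longrightarrow>
      \<Phi> X $$ (r,s) = (\<Sum>p<d. \<Sum>q<d. C p q r s * X $$ (p,q))"
  shows "decomposable d d \<Phi>"
proof -
  obtain K L where KL: "\<And>p q r s. p < d \<Longrightarrow> q < d \<Longrightarrow> r < d \<Longrightarrow> s < d \<Longrightarrow>
      C p q r s = (\<Sum>\<kappa><N. K \<kappa> r p * cnj (K \<kappa> s q) + L \<kappa> s p * cnj (L \<kappa> r q))"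
    using assms(1) unfolding kraus_decomposition_def by blast
  have "\<Phi> X = kraus_map d N K X + transpose_mat (kraus_map d N L X)" if X: "X \<in> carrier_mat d d" for X
  proof (rule eq_matI)
    fix r s assume "r < dim_row (kraus_map d N K X + transpose_mat (kraus_map d N L X))"
      "s < dim_col (kraus_map d N K X + transpose_mat (kraus_map d N L X))"
    then have rs: "r < d" "s < d" by (auto simp: kraus_map_def)
    have "\<Phi> X $$ (r,s) = (\<Sum>p<d. \<Sum>q<d. \<Sum>\<kappa><N. K \<kappa> r p * X $$ (p,q) * cnj (K \<kappa> s q) + L \<kappa> s p * X $$ (p,q) * cnj (L \<kappa> r q))"
      unfolding entry[OF X rs]
    proof (intro sum.cong refl)
      fix p q assume "p \<in> {..<d}" "q \<in> {..<d}"
      then show "C p q r s * X $$ (p,q) = (\<Sum>\<kappa><N. K \<kappa> r p * X $$ (p,q) * cnj (K \<kappa> s q) + L \<kappa> s p * X $$ (p,q) * cnj (L \<kappa> r q))"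
        by (simp add: KL rs sum_distrib_right) (simp add: algebra_simps)
    qed
    also have "\<dots> = (\<Sum>\<kappa><N. \<Sum>p<d. \<Sum>q<d. K \<kappa> r p * X $$ (p,q) * cnj (K \<kappa> s q) + L \<kappa> s p * X $$ (p,q) * cnj (L \<kappa> r q))"
      by (rule sum_swap3)
    finally show "\<Phi> X $$ (r,s) = (kraus_map d N K X + transpose_mat (kraus_map d N L X)) $$ (r,s)"
      using rs by (simp add: kraus_map_def sum.distrib)
  qed (use car[OF X] in \<open>auto simp: kraus_map_def\<close>)
  then show ?thesis
    unfolding decomposable_def using kraus_completely_positive by blast
qed

section \<open>The tensor square as a quartic form\<close>

text \<open>The index type \<open>2\<close> has the elements \<open>1\<close> and \<open>2 = 0\<close>; the composite index \<open>p < 4\<close> of the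
  Kronecker ordering is \<open>2 * idx (hi p) + idx (lo p)\<close>.\<close>

definition idx :: "2 \<Rightarrow> nat" where "idx i = (if i = 1 then 1 else 0)"
definition hi :: "nat \<Rightarrow> 2" where "hi p = (if p div 2 = 1 then 1 else 2)"
definition lo :: "nat \<Rightarrow> 2" where "lo p = (if p mod 2 = 1 then 1 else 2)"

definition map_coeff :: "(complex mat \<Rightarrow> complex mat) \<Rightarrow> 2 \<Rightarrow> 2 \<Rightarrow> 2 \<Rightarrow> 2 \<Rightarrow> complex" where
  "map_coeff P i j k l = P (unit_mat 2 (idx i) (idx j)) $$ (idx k, idx l)"

definition tens :: "(2 \<Rightarrow> 2 \<Rightarrow> 2 \<Rightarrow> 2 \<Rightarrow> complex) \<Rightarrow> nat \<Rightarrow> nat \<Rightarrow> nat \<Rightarrow> nat \<Rightarrow> complex" where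
  "tens c p q r s = c (hi p) (hi q) (hi r) (hi s) * c (lo p) (lo q) (lo r) (lo s)"

text \<open>For \<open>c = map_coeff P\<close> this is \<open>\<langle>v, P(x y*) u\<rangle>\<close>.\<close>

definition sform :: "(2 \<Rightarrow> 2 \<Rightarrow> 2 \<Rightarrow> 2 \<Rightarrow> complex) \<Rightarrow> complex^2 \<Rightarrow> complex^2 \<Rightarrow> complex^2 \<Rightarrow> complex^2 \<Rightarrow> complex" where
  "sform c x y v u = (\<Sum>i\<in>UNIV. \<Sum>j\<in>UNIV. \<Sum>k\<in>UNIV. \<Sum>l\<in>UNIV. c i j k l * x$i * cnj (y$j) * cnj (v$k) * u$l)"

text \<open>For the arrays of P and Q this is the quadratic form at \<phi> of P \<otimes> Q applied
  to the rank-one matrix of \<psi>, where \<psi> is the sum of the \<open>w x \<otimes> w' x\<close>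
  and \<phi> that of the \<open>v y \<otimes> v' y\<close>. Two summands reach every vector of the
  tensor product. Separate arrays \<open>c\<close> and \<open>d\<close> allow expanding the square
  of a sum of maps.\<close>

definition tform :: "(2 \<Rightarrow> 2 \<Rightarrow> 2 \<Rightarrow> 2 \<Rightarrow> complex) \<Rightarrow> (2 \<Rightarrow> 2 \<Rightarrow> 2 \<Rightarrow> 2 \<Rightarrow> complex) \<Rightarrow>
    (2 \<Rightarrow> complex^2) \<Rightarrow> (2 \<Rightarrow> complex^2) \<Rightarrow> (2 \<Rightarrow> complex^2) \<Rightarrow> (2 \<Rightarrow> complex^2) \<Rightarrow> complex" where
  "tform c d w w' v v' = (\<Sum>x\<in>UNIV. \<Sum>x'\<in>UNIV. \<Sum>y\<in>UNIV. \<Sum>y'\<in>UNIV.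
     sform c (w x) (w x') (v y) (v y') * sform d (w' x) (w' x') (v' y) (v' y'))"

lemma idx_simps [simp]: "idx 1 = 1" "idx 2 = 0"
  by (simp_all add: idx_def)

lemma idx_hi: "p < 4 \<Longrightarrow> idx (hi p) = p div 2" and idx_lo: "idx (lo p) = p mod 2"
  by (auto simp: hi_def lo_def idx_def)

lemma sum_lt_4: "(\<Sum>p<4. f p) = f 0 + f 1 + f 2 + f (3::nat)" for f :: "nat \<Rightarrow> 'a::comm_monoid_add"
  by (simp add: numeral_eq_Suc add.assoc)

lemma sum_lt_2: "(\<Sum>p<2. f p) = f 0 + f (1::nat)" for f :: "nat \<Rightarrow> 'a::comm_monoid_add"
  by (simp add: numeral_eq_Suc)

lemma hi_lo_simps [simp]: "hi 0 = 2" "hi 1 = 2" "hi (Suc 0) = 2" "hi 2 = 1" "hi 3 = 1" "lo 0 = 2" "lo 1 = 1" "lo (Suc 0) = 1" "lo 2 = 2" "lo 3 = 1"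
  by (simp_all add: hi_def lo_def)

lemma unit_mat_carrier: "unit_mat d a b \<in> carrier_mat d d"
  by (simp add: unit_mat_def)

lemma lin_map_entry:
  assumes P: "lin_map 2 2 P" and B: "B \<in> carrier_mat 2 2" and kl: "k < 2" "l < 2"
  shows "P B $$ (k,l) = (\<Sum>i<2. \<Sum>j<2. B $$ (i,j) * P (unit_mat 2 i j) $$ (k,l))"
proof -
  let ?E = "unit_mat 2"
  let ?b = "\<lambda>i j. B $$ (i,j) \<cdot>\<^sub>m ?E i j"
  have car: "?b i j \<in> carrier_mat 2 2" "P (?E i j) \<in> carrier_mat 2 2" for i j
    using P unfolding lin_map_def by (auto simp: unit_mat_carrier)
  have add: "\<And>A B. A \<in> carrier_mat 2 2 \<Longrightarrow> B \<in> carrier_mat 2 2 \<Longrightarrow> P (A + B) = P A + P B"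
    and sc: "P (?b i j) = B $$ (i,j) \<cdot>\<^sub>m P (?E i j)" for i j
    using P unfolding lin_map_def by (auto simp: unit_mat_carrier)
  have "B = (?b 0 0 + ?b 0 1) + (?b 1 0 + ?b 1 1)"
  proof (rule eq_matI)
    fix i j assume "i < dim_row ((?b 0 0 + ?b 0 1) + (?b 1 0 + ?b 1 1))" "j < dim_col ((?b 0 0 + ?b 0 1) + (?b 1 0 + ?b 1 1))"
    then have "i < 2" "j < 2" by (simp_all add: unit_mat_def)
    then show "B $$ (i,j) = ((?b 0 0 + ?b 0 1) + (?b 1 0 + ?b 1 1)) $$ (i,j)"
      by (auto simp: unit_mat_def less_2_cases_iff)
  qed (use B in \<open>simp_all add: unit_mat_def\<close>)
  then have "P B = P ((?b 0 0 + ?b 0 1) + (?b 1 0 + ?b 1 1))" by simp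
  also have "\<dots> = (P (?b 0 0) + P (?b 0 1)) + (P (?b 1 0) + P (?b 1 1))"
    using car by (simp add: add)
  finally have "P B = (B $$ (0,0) \<cdot>\<^sub>m P (?E 0 0) + B $$ (0,1) \<cdot>\<^sub>m P (?E 0 1)) + (B $$ (1,0) \<cdot>\<^sub>m P (?E 1 0) + B $$ (1,1) \<cdot>\<^sub>m P (?E 1 1))"
    by (simp add: sc)
  moreover have "P (?E i j) \<in> carrier_mat 2 2" for i j by (rule car)
  note this[THEN carrier_matD(1)] this[THEN carrier_matD(2)]
  ultimately show ?thesis using kl by (simp add: sum_lt_2)
qed

lemma tensor_entry:
  assumes P: "lin_map 2 2 P" and X: "X \<in> carrier_mat 4 4" and rs: "r < 4" "s < 4"
  shows "tensor_map 2 2 2 2 P P X $$ (r,s) = (\<Sum>p<4. \<Sum>q<4. tens (map_coeff P) p q r s * X $$ (p,q))"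
proof -
  have blk: "blk 2 X i j \<in> carrier_mat 2 2" for i j by (simp add: blk_def)
  have "tensor_map 2 2 2 2 P P X $$ (r,s) = (\<Sum>i<2. \<Sum>j<2. P (unit_mat 2 i j) $$ (r div 2, s div 2) *
      (\<Sum>i'<2. \<Sum>j'<2. X $$ (i*2+i',j*2+j') * P (unit_mat 2 i' j') $$ (r mod 2, s mod 2)))"
    using rs unfolding tensor_map_def
    by (simp add: lin_map_entry[OF P blk]) (simp add: blk_def)
  also have "\<dots> = (\<Sum>p<4. \<Sum>q<4. tens (map_coeff P) p q r s * X $$ (p,q))"
    using rs by (simp add: tens_def map_coeff_def idx_hi idx_lo sum_lt_2 sum_lt_4 algebra_simps)
      (simp add: numeral_2_eq_2 numeral_3_eq_3 algebra_simps)
  finally show ?thesis .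
qed

lemma tensor_map_carrier: "tensor_map a b c e P Q X \<in> carrier_mat (c*e) (c*e)"
  by (simp add: tensor_map_def)

lemma psd_rank_one: "psd n (Matrix.mat n n (\<lambda>(r,s). \<psi> r * cnj (\<psi> s)))"
proof (rule psd_kraus[where m = 1 and N = 1 and M = "\<lambda>\<kappa> r p. \<psi> r" and A = "Matrix.mat 1 1 (\<lambda>_. 1)"])
  show "psd 1 (Matrix.mat 1 1 (\<lambda>_. 1))"
    by (auto simp: psd_def)
qed auto

lemma positive_map_form:
  assumes pos: "positive_map d d \<Phi>"
    and entry: "\<And>X r s. X \<in> carrier_mat d d \<Longrightarrow> r < d \<Longrightarrow> s < d \<Longrightarrow>
      \<Phi> X $$ (r,s) = (\<Sum>p<d. \<Sum>q<d. C p q r s * X $$ (p,q))"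
  shows "Im (\<Sum>r<d. \<Sum>s<d. \<Sum>p<d. \<Sum>q<d. C p q r s * \<psi> p * cnj (\<psi> q) * cnj (\<phi> r) * \<phi> s) = 0 \<and>
    Re (\<Sum>r<d. \<Sum>s<d. \<Sum>p<d. \<Sum>q<d. C p q r s * \<psi> p * cnj (\<psi> q) * cnj (\<phi> r) * \<phi> s) \<ge> 0"
proof -
  let ?X = "Matrix.mat d d (\<lambda>(r,s). \<psi> r * cnj (\<psi> s))"
  have "psd d (\<Phi> ?X)" using pos psd_rank_one unfolding positive_map_def by blast
  then have *: "Im (\<Sum>i<d. \<Sum>j<d. cnj (v i) * \<Phi> ?X $$ (i, j) * v j) = 0
        \<and> Re (\<Sum>i<d. \<Sum>j<d. cnj (v i) * \<Phi> ?X $$ (i, j) * v j) \<ge> 0" for v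
    unfolding psd_def by blast
  have "(\<Sum>i<d. \<Sum>j<d. cnj (\<phi> i) * \<Phi> ?X $$ (i, j) * \<phi> j)
    = (\<Sum>r<d. \<Sum>s<d. \<Sum>p<d. \<Sum>q<d. C p q r s * \<psi> p * cnj (\<psi> q) * cnj (\<phi> r) * \<phi> s)"
    by (intro sum.cong refl) (simp add: entry sum_distrib_left sum_distrib_right mult_ac)
  with *[of \<phi>] show ?thesis by simp
qed

lemma sum_hi_lo: "(\<Sum>p<4. f (hi p) * g (lo p)) = (\<Sum>i\<in>UNIV. f i) * (\<Sum>i\<in>UNIV. g i)"
  for f g :: "2 \<Rightarrow> complex"
  by (simp add: sum_lt_4 sum_2 algebra_simps)

lemma sum_tens:
  fixes F G :: "2 \<Rightarrow> 2 \<Rightarrow> 2 \<Rightarrow> 2 \<Rightarrow> complex"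
  shows "(\<Sum>r<4. \<Sum>s<4. \<Sum>p<4. \<Sum>q<4. F (hi r) (hi s) (hi p) (hi q) * G (lo r) (lo s) (lo p) (lo q))
    = (\<Sum>k\<in>UNIV. \<Sum>l\<in>UNIV. \<Sum>i\<in>UNIV. \<Sum>j\<in>UNIV. F k l i j) * (\<Sum>k\<in>UNIV. \<Sum>l\<in>UNIV. \<Sum>i\<in>UNIV. \<Sum>j\<in>UNIV. G k l i j)"
proof -
  have 1: "(\<Sum>q<4. F a b c (hi q) * G a' b' c' (lo q)) = (\<Sum>j\<in>UNIV. F a b c j) * (\<Sum>j\<in>UNIV. G a' b' c' j)" for a b c a' b' c'
    by (rule sum_hi_lo)
  have 2: "(\<Sum>p<4. (\<Sum>j\<in>UNIV. F a b (hi p) j) * (\<Sum>j\<in>UNIV. G a' b' (lo p) j))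
     = (\<Sum>i\<in>UNIV. \<Sum>j\<in>UNIV. F a b i j) * (\<Sum>i\<in>UNIV. \<Sum>j\<in>UNIV. G a' b' i j)" for a b a' b'
    by (rule sum_hi_lo)
  have 3: "(\<Sum>p<4. (\<Sum>i\<in>UNIV. \<Sum>j\<in>UNIV. F a (hi p) i j) * (\<Sum>i\<in>UNIV. \<Sum>j\<in>UNIV. G a' (lo p) i j))
     = (\<Sum>l\<in>UNIV. \<Sum>i\<in>UNIV. \<Sum>j\<in>UNIV. F a l i j) * (\<Sum>l\<in>UNIV. \<Sum>i\<in>UNIV. \<Sum>j\<in>UNIV. G a' l i j)" for a a'
    by (rule sum_hi_lo)
  show ?thesis unfolding 1 2 3 by (rule sum_hi_lo)
qed

lemma sform_flip: "sform c x y v u =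
  (\<Sum>k\<in>UNIV. \<Sum>l\<in>UNIV. \<Sum>i\<in>UNIV. \<Sum>j\<in>UNIV. c i j k l * x$i * cnj (y$j) * cnj (v$k) * u$l)"
  unfolding sform_def by (simp add: sum_2 algebra_simps)

lemma tens_form_product:
  "(\<Sum>r<4. \<Sum>s<4. \<Sum>p<4. \<Sum>q<4. tens c p q r s * (x$(hi p) * x'$(lo p)) * cnj (y$(hi q) * y'$(lo q))
     * cnj (v$(hi r) * v'$(lo r)) * (u$(hi s) * u'$(lo s)))
   = sform c x y v u * sform c x' y' v' u'"
proof -
  have "?thesis \<longleftrightarrow> (\<Sum>r<4. \<Sum>s<4. \<Sum>p<4. \<Sum>q<4.
      (c (hi p) (hi q) (hi r) (hi s) * x$(hi p) * cnj (y$(hi q)) * cnj (v$(hi r)) * u$(hi s)) *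
      (c (lo p) (lo q) (lo r) (lo s) * x'$(lo p) * cnj (y'$(lo q)) * cnj (v'$(lo r)) * u'$(lo s)))
   = sform c x y v u * sform c x' y' v' u'"
    by (simp add: tens_def mult_ac)
  then show ?thesis
    unfolding sform_flip
    using sum_tens[of "\<lambda>k l i j. c i j k l * x$i * cnj (y$j) * cnj (v$k) * u$l"
      "\<lambda>k l i j. c i j k l * x'$i * cnj (y'$j) * cnj (v'$k) * u'$l"] by simp
qed

text \<open>Expanding both vectors into their product summands, in all four slots, leaves values at
  product vectors, where the form of the tensor square factors.\<close>

lemma tform_nonneg:
  assumes P: "lin_map 2 2 P" and pos: "positive_map 4 4 (tensor_map 2 2 2 2 P P)"
  shows "Im (tform (map_coeff P) (map_coeff P) w w' v v') = 0 \<and> Re (tform (map_coeff P) (map_coeff P) w w' v v') \<ge> 0"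
proof -
  define \<psi> where "\<psi> p = (\<Sum>x\<in>UNIV. w x$(hi p) * w' x$(lo p))" for p
  define \<phi> where "\<phi> p = (\<Sum>x\<in>UNIV. v x$(hi p) * v' x$(lo p))" for p
  let ?C = "tens (map_coeff P)"
  let ?Z = "\<lambda>x y v u. \<Sum>r<4. \<Sum>s<4. \<Sum>p<4. \<Sum>q<4. ?C p q r s * x p * cnj (y q) * cnj (v r) * u s"
  let ?a = "\<lambda>x p. w x$(hi p) * w' x$(lo p)" and ?b = "\<lambda>y p. v y$(hi p) * v' y$(lo p)"
  have Z1: "?Z (\<lambda>p. f p + g p) y v u = ?Z f y v u + ?Z g y v u"
   and Z2: "?Z x (\<lambda>p. f p + g p) v u = ?Z x f v u + ?Z x g v u"
   and Z3: "?Z x y (\<lambda>p. f p + g p) u = ?Z x y f u + ?Z x y g u"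
   and Z4: "?Z x y v (\<lambda>p. f p + g p) = ?Z x y v f + ?Z x y v g" for f g x y v u
    by (simp_all only: distrib_left distrib_right complex_cnj_add sum.distrib)
  have "?Z \<psi> \<psi> \<phi> \<phi> = (\<Sum>x\<in>UNIV. \<Sum>x'\<in>UNIV. \<Sum>y\<in>UNIV. \<Sum>y'\<in>UNIV. ?Z (?a x) (?a x') (?b y) (?b y'))"
    unfolding \<psi>_def \<phi>_def sum_2 Z1 Z2 Z3 Z4 by (simp only: add_ac)
  also have "\<dots> = tform (map_coeff P) (map_coeff P) w w' v v'"
    unfolding tform_def by (intro sum.cong refl tens_form_product)
  finally have "tform (map_coeff P) (map_coeff P) w w' v v' = ?Z \<psi> \<psi> \<phi> \<phi>" ..
  then show ?thesis
    using positive_map_form[OF pos tensor_entry[OF P]] by simp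
qed

lemma kraus_decomposition_imp_decomposable_tensor:
  assumes P: "lin_map 2 2 P" and "kraus_decomposition 4 N (tens (map_coeff P))"
  shows "decomposable 4 4 (tensor_map 2 2 2 2 P P)"
  using tensor_map_carrier[of 2 2 2 2]
  by (intro kraus_decomposition_imp_decomposable[OF assms(2)] tensor_entry[OF P]) auto

section \<open>Closedness and reduction to strictly positive maps\<close>

text \<open>Each new index refines the subsequence found so far, and the earlier limits persist
  along it.\<close>

lemma bounded_family_convergent_subsequence:
  fixes f :: "nat \<Rightarrow> 'i \<Rightarrow> complex"
  assumes "finite I" "\<And>i. i \<in> I \<Longrightarrow> bounded (range (\<lambda>n. f n i))"
  shows "\<exists>r l. strict_mono (r :: nat \<Rightarrow> nat) \<and> (\<forall>i\<in>I. (\<lambda>n. f (r n) i) \<longlonglongrightarrow> l i)"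
  using assms
proof (induction I)
  case empty
  have "strict_mono (id :: nat \<Rightarrow> nat)" by (simp add: strict_mono_def)
  then show ?case by blast
next
  case (insert a I)
  obtain r l where r: "strict_mono (r :: nat \<Rightarrow> nat)" and l: "\<And>i. i \<in> I \<Longrightarrow> (\<lambda>n. f (r n) i) \<longlonglongrightarrow> l i"
    using insert by blast
  have "bounded (range (\<lambda>n. f (r n) a))"
    using insert.prems[of a] by (rule bounded_subset) auto
  then obtain r' z where r': "strict_mono (r' :: nat \<Rightarrow> nat)" and z: "((\<lambda>n. f (r n) a) \<circ> r') \<longlonglongrightarrow> z"
    using bounded_imp_convergent_subsequence by blast
  have "(\<lambda>n. f ((r \<circ> r') n) i) \<longlonglongrightarrow> (l(a := z)) i" if "i \<in> insert a I" for i
  proof (cases "i = a")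
    case True
    then show ?thesis using z by (simp add: o_def)
  next
    case False
    then have "((\<lambda>n. f (r n) i) \<circ> r') \<longlonglongrightarrow> l i" using that l r' by (intro LIMSEQ_subseq_LIMSEQ) auto
    then show ?thesis using False by (simp add: o_def)
  qed
  moreover have "strict_mono (r \<circ> r')" using r r' by (rule strict_mono_o)
  ultimately show ?case by blast
qed

text \<open>Compactness with a fixed number \<open>N\<close> of operators: the sum of the entries
  \<open>C n p p r r\<close> is the sum of all squared moduli of Kraus entries. It converges, hence
  bounds them uniformly in \<open>n\<close>, and limits along a common subsequence are Kraus
  operators for \<open>C0\<close>.\<close>

lemma kraus_decomposition_limit:
  assumes C: "\<And>n. kraus_decomposition d N (C n)"
    and lim: "\<And>p q r s. p < d \<Longrightarrow> q < d \<Longrightarrow> r < d \<Longrightarrow> s < d \<Longrightarrow> (\<lambda>n. C n p q r s) \<longlonglongrightarrow> C0 p q r s"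
  shows "kraus_decomposition d N C0"
proof -
  have "\<forall>n. \<exists>K L. \<forall>p<d. \<forall>q<d. \<forall>r<d. \<forall>s<d. C n p q r s =
     (\<Sum>\<kappa><N. K \<kappa> r p * cnj (K \<kappa> s q) + L \<kappa> s p * cnj (L \<kappa> r q))"
    using C unfolding kraus_decomposition_def by blast
  from choice[OF this] obtain K where "\<forall>n. \<exists>L. \<forall>p<d. \<forall>q<d. \<forall>r<d. \<forall>s<d. C n p q r s =
     (\<Sum>\<kappa><N. K n \<kappa> r p * cnj (K n \<kappa> s q) + L \<kappa> s p * cnj (L \<kappa> r q))"
    by blast
  from choice[OF this] obtain L where KL: "\<And>n p q r s. p < d \<Longrightarrow> q < d \<Longrightarrow> r < d \<Longrightarrow> s < d \<Longrightarrow> C n p q r s =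
     (\<Sum>\<kappa><N. K n \<kappa> r p * cnj (K n \<kappa> s q) + L n \<kappa> s p * cnj (L n \<kappa> r q))"
    by blast
  have "convergent (\<lambda>n. \<Sum>p<d. \<Sum>r<d. C n p p r r)"
    unfolding convergent_def using lim by (intro exI[of _ "\<Sum>p<d. \<Sum>r<d. C0 p p r r"] tendsto_sum) auto
  then obtain B where B: "\<And>n. norm (\<Sum>p<d. \<Sum>r<d. C n p p r r) \<le> B"
    using convergent_imp_bounded[of "\<lambda>n. \<Sum>p<d. \<Sum>r<d. C n p p r r"] unfolding convergent_def bounded_iff by auto
  have diag: "(\<Sum>p<d. \<Sum>r<d. C n p p r r)
      = of_real (\<Sum>p<d. \<Sum>r<d. \<Sum>\<kappa><N. (norm (K n \<kappa> r p))\<^sup>2 + (norm (L n \<kappa> r p))\<^sup>2)" for n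
    by (simp add: KL complex_norm_square del: of_real_power)
  have KLb: "(norm (K n \<kappa> r p))\<^sup>2 + (norm (L n \<kappa> r p))\<^sup>2 \<le> B" if "\<kappa> < N" "r < d" "p < d" for n \<kappa> r p
  proof -
    have "(norm (K n \<kappa> r p))\<^sup>2 + (norm (L n \<kappa> r p))\<^sup>2 \<le> (\<Sum>\<kappa><N. (norm (K n \<kappa> r p))\<^sup>2 + (norm (L n \<kappa> r p))\<^sup>2)"
      using that by (intro member_le_sum) auto
    also have "\<dots> \<le> (\<Sum>r<d. \<Sum>\<kappa><N. (norm (K n \<kappa> r p))\<^sup>2 + (norm (L n \<kappa> r p))\<^sup>2)"
      using that by (intro member_le_sum[of r "{..<d}" "\<lambda>r. \<Sum>\<kappa><N. (norm (K n \<kappa> r p))\<^sup>2 + (norm (L n \<kappa> r p))\<^sup>2"] sum_nonneg) auto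
    also have "\<dots> \<le> (\<Sum>p<d. \<Sum>r<d. \<Sum>\<kappa><N. (norm (K n \<kappa> r p))\<^sup>2 + (norm (L n \<kappa> r p))\<^sup>2)"
      using that by (intro member_le_sum[of p "{..<d}" "\<lambda>p. \<Sum>r<d. \<Sum>\<kappa><N. (norm (K n \<kappa> r p))\<^sup>2 + (norm (L n \<kappa> r p))\<^sup>2"] sum_nonneg) auto
    also have "\<dots> \<le> B" using B[of n] unfolding diag norm_of_real by linarith
    finally show ?thesis .
  qed
  define f where "f n = (\<lambda>(b,\<kappa>,r,p). if b then K n \<kappa> r p else L n \<kappa> r p)" for n
  define I where "I = (UNIV :: bool set) \<times> {..<N} \<times> {..<d} \<times> {..<d}"
  have "bounded (range (\<lambda>n. f n i))" if "i \<in> I" for i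
  proof -
    obtain b \<kappa> r p where i: "i = (b,\<kappa>,r,p)" by (cases i)
    have "norm (f n i) \<le> sqrt B" for n
    proof (rule real_le_rsqrt)
      have "(norm (f n i))\<^sup>2 \<le> (norm (K n \<kappa> r p))\<^sup>2 + (norm (L n \<kappa> r p))\<^sup>2"
        by (simp add: f_def i)
      also have "\<dots> \<le> B" using that i by (intro KLb) (auto simp: I_def)
      finally show "(norm (f n i))\<^sup>2 \<le> B" .
    qed
    then show ?thesis unfolding bounded_iff by blast
  qed
  moreover have "finite I" unfolding I_def by simp
  ultimately obtain \<rho> l where \<rho>: "strict_mono (\<rho> :: nat \<Rightarrow> nat)" and l: "\<And>i. i \<in> I \<Longrightarrow> (\<lambda>n. f (\<rho> n) i) \<longlonglongrightarrow> l i"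
    using bounded_family_convergent_subsequence[of I f] by blast
  define K0 where "K0 \<kappa> r p = l (True,\<kappa>,r,p)" for \<kappa> r p
  define L0 where "L0 \<kappa> r p = l (False,\<kappa>,r,p)" for \<kappa> r p
  have K0: "(\<lambda>n. K (\<rho> n) \<kappa> r p) \<longlonglongrightarrow> K0 \<kappa> r p" and L0: "(\<lambda>n. L (\<rho> n) \<kappa> r p) \<longlonglongrightarrow> L0 \<kappa> r p"
    if "\<kappa> < N" "r < d" "p < d" for \<kappa> r p
    using l[of "(True,\<kappa>,r,p)"] l[of "(False,\<kappa>,r,p)"] that by (auto simp: I_def f_def K0_def L0_def)
  have "C0 p q r s = (\<Sum>\<kappa><N. K0 \<kappa> r p * cnj (K0 \<kappa> s q) + L0 \<kappa> s p * cnj (L0 \<kappa> r q))"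
    if pqrs: "p < d" "q < d" "r < d" "s < d" for p q r s
  proof (rule LIMSEQ_unique)
    show "(\<lambda>n. C (\<rho> n) p q r s) \<longlonglongrightarrow> C0 p q r s"
      using LIMSEQ_subseq_LIMSEQ[OF lim[OF pqrs] \<rho>] by (simp add: o_def)
    show "(\<lambda>n. C (\<rho> n) p q r s) \<longlonglongrightarrow> (\<Sum>\<kappa><N. K0 \<kappa> r p * cnj (K0 \<kappa> s q) + L0 \<kappa> s p * cnj (L0 \<kappa> r q))"
      unfolding KL[OF pqrs] using pqrs by (intro tendsto_intros K0 L0) auto
  qed
  then show ?thesis unfolding kraus_decomposition_def by blast
qed

section \<open>Polarisation of forms on two-dimensional space\<close>

abbreviation bq :: "(2 \<Rightarrow> 2 \<Rightarrow> 2 \<Rightarrow> 2 \<Rightarrow> complex) \<Rightarrow> complex^2 \<Rightarrow> complex^2 \<Rightarrow> complex" where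
  "bq c w v \<equiv> sform c w w v v"

definition vec2 :: "complex \<Rightarrow> complex \<Rightarrow> complex^2" where
  "vec2 a b = (\<chi> i. if i = 1 then a else b)"

lemma vec2_simps [simp]: "vec2 a b $ 1 = a" "vec2 a b $ 2 = b"
  by (simp_all add: vec2_def)

text \<open>Polarisation: the vectors (1,0), (0,1), (1,1) and (1,\<i>) determine all four
  coefficients.\<close>

lemma sesquilinear_form_eq_0:
  fixes m :: "2 \<Rightarrow> 2 \<Rightarrow> complex"
  assumes "\<And>v :: complex^2. (\<Sum>k\<in>UNIV. \<Sum>l\<in>UNIV. m k l * cnj (v$k) * v$l) = 0"
  shows "m k l = 0"
proof -
  have 1: "m 1 1 = 0" using assms[of "vec2 1 0"] by (simp add: sum_2)
  have 2: "m 2 2 = 0" using assms[of "vec2 0 1"] by (simp add: sum_2)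
  have 3: "m 1 2 + m 2 1 = 0" using assms[of "vec2 1 1"] 1 2 by (simp add: sum_2)
  have 4: "m 1 2 * \<i> - m 2 1 * \<i> = 0" using assms[of "vec2 1 \<i>"] 1 2 by (simp add: sum_2)
  have 5: "m 1 2 = m 2 1" using 4 by (simp add: left_diff_distrib[symmetric])
  then have "m 1 2 = 0" "m 2 1 = 0" using 3 by simp_all
  with 1 2 show ?thesis using exhaust_2[of k] exhaust_2[of l] by auto
qed

lemma sform_diff: "sform (\<lambda>i j k l. c i j k l - d i j k l) x y v u = sform c x y v u - sform d x y v u"
  by (simp add: sform_def sum_subtractf algebra_simps)

text \<open>Polarise in \<open>v\<close> for fixed \<open>w\<close>, then in \<open>w\<close>. Thus
  an array is determined by its values on rank-one matrices.\<close>

lemma bq_eq_0: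
  assumes "\<And>w v. bq c w v = 0" shows "c i j k l = 0"
proof -
  have "(\<Sum>i\<in>UNIV. \<Sum>j\<in>UNIV. c j i k l * cnj (w$i) * w$j) = 0" for w :: "complex^2" and k l
  proof (rule sesquilinear_form_eq_0)
    fix v :: "complex^2"
    have "(\<Sum>k\<in>UNIV. \<Sum>l\<in>UNIV. (\<Sum>i\<in>UNIV. \<Sum>j\<in>UNIV. c j i k l * cnj (w$i) * w$j) * cnj (v$k) * v$l) = bq c w v"
      by (simp add: sform_def sum_2 algebra_simps)
    then show "(\<Sum>k\<in>UNIV. \<Sum>l\<in>UNIV. (\<Sum>i\<in>UNIV. \<Sum>j\<in>UNIV. c j i k l * cnj (w$i) * w$j) * cnj (v$k) * v$l) = 0"
      using assms by simp
  qed
  from sesquilinear_form_eq_0[OF this] show ?thesis .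
qed

lemma bq_eqI:
  assumes "\<And>w v. bq c w v = bq d w v" shows "c = d"
  using bq_eq_0[of "\<lambda>i j k l. c i j k l - d i j k l"] assms by (auto simp: sform_diff fun_eq_iff)

lemma cnj_sform: "cnj (sform c x y v u) = sform (\<lambda>i j k l. cnj (c j i l k)) y x u v"
  by (simp add: sform_def sum_2 algebra_simps)

text \<open>The conjugated array has the conjugated values of \<open>bq\<close>, which are the same
  values, so the two arrays agree.\<close>

lemma hermitian_if_bq_real:
  assumes "\<And>w v. bq c w v \<in> \<real>" shows "c i j k l = cnj (c j i l k)"
proof -
  have "c = (\<lambda>i j k l. cnj (c j i l k))"
    by (rule bq_eqI) (metis assms cnj_sform Reals_cnj_iff)
  then show ?thesis by metis
qed

lemma sform_zero [simp]: "sform c 0 y v u = 0" "sform c x 0 v u = 0" "sform c x y 0 u = 0" "sform c x y v 0 = 0"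
  by (simp_all add: sform_def)

lemma sform_add:
  "sform c (x + x') y v u = sform c x y v u + sform c x' y v u"
  "sform c x (y + y') v u = sform c x y v u + sform c x y' v u"
  "sform c x y (v + v') u = sform c x y v u + sform c x y v' u"
  "sform c x y v (u + u') = sform c x y v u + sform c x y v u'"
  by (simp_all add: sform_def sum.distrib algebra_simps)

lemma sform_scale:
  "sform c (a *s x) y v u = a * sform c x y v u"
  "sform c x (a *s y) v u = cnj a * sform c x y v u"
  "sform c x y (a *s v) u = cnj a * sform c x y v u"
  "sform c x y v (a *s u) = a * sform c x y v u"
  by (simp_all add: sform_def sum_distrib_left mult_ac)

lemma sform_array_linear:
  "sform (\<lambda>i j k l. a * c i j k l + b * d i j k l) x y v u = a * sform c x y v u + b * sform d x y v u"
  by (simp add: sform_def sum.distrib sum_distrib_left algebra_simps)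

lemma tform_swap: "tform c d w w' v v' = tform d c w' w v' v"
  by (simp add: tform_def mult.commute)

lemma tform_linear: 
  "tform (\<lambda>i j k l. a * c i j k l + b * d i j k l) e w w' v v' = a * tform c e w w' v v' + b * tform d e w w' v v'"
  "tform e (\<lambda>i j k l. a * c i j k l + b * d i j k l) w w' v v' = a * tform e c w w' v v' + b * tform e d w w' v v'"
  by (simp_all add: tform_def sform_array_linear sum.distrib sum_distrib_left algebra_simps)

section \<open>The sign of the map and its strictly positive perturbations\<close>

lemma positive_or_negative_if_tform_nonneg:
  assumes "\<And>w w' v v'. tform c c w w' v v' \<in> \<real>\<^sub>\<ge>\<^sub>0"
  shows "(\<forall>w v. bq c w v \<in> \<real>\<^sub>\<ge>\<^sub>0) \<or> (\<forall>w v. - bq c w v \<in> \<real>\<^sub>\<ge>\<^sub>0)"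
proof -
  \<comment> \<open>On product vectors the form is a product of two values of \<open>bq\<close>, so
    one nonzero value fixes the sign of all others.\<close>
  have prod: "bq c w v * bq c w' v' \<in> \<real>\<^sub>\<ge>\<^sub>0" for w v w' v'
    using assms[of "\<lambda>x. if x = 1 then w else 0" "\<lambda>x. if x = 1 then w' else 0"
      "\<lambda>x. if x = 1 then v else 0" "\<lambda>x. if x = 1 then v' else 0"]
    by (simp add: tform_def sum_2)
  show ?thesis
  proof (cases "\<forall>w v. bq c w v = 0")
    case False
    then obtain w0 v0 where z: "bq c w0 v0 \<noteq> 0" by blast
    define z where "z = bq c w0 v0"
    have zz: "z * z \<in> \<real>\<^sub>\<ge>\<^sub>0" and z0: "z \<noteq> 0" using prod[of w0 v0 w0 v0] z by (simp_all add: z_def)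
    \<comment> \<open>A complex number whose square is a nonnegative real is itself real.\<close>
    then have Im: "Im z = 0" 
      by (auto simp: complex_nonneg_Reals_iff complex_eq_iff)
         (metis mult_zero_left not_square_less_zero order_less_le zero_le_mult_iff diff_0 neg_0_le_iff_le mult_eq_0_iff)
    have "Re z * Re (bq c w v) \<ge> 0 \<and> Re z * Im (bq c w v) = 0" for w v
      using prod[of w0 v0 w v] Im by (simp add: complex_nonneg_Reals_iff flip: z_def)
    moreover have "Re z \<noteq> 0" using Im z0 by (simp add: complex_eq_iff)
    ultimately show ?thesis
      by (cases "Re z > 0") (auto simp: complex_nonneg_Reals_iff zero_le_mult_iff)
  qed auto
qed

text \<open>The array of the map X \<mapsto> tr(X) I.\<close>

definition delta :: "2 \<Rightarrow> 2 \<Rightarrow> 2 \<Rightarrow> 2 \<Rightarrow> complex" where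
  "delta i j k l = (if i = j \<and> k = l then 1 else 0)"

lemma sform_delta: "sform delta x y v u = (\<Sum>a\<in>UNIV. \<Sum>b\<in>UNIV. x$a * cnj (y$a) * cnj (v$b) * u$b)"
  by (simp add: sform_def delta_def sum_2)

lemma norm_vec_2: "(norm (x :: complex^2))\<^sup>2 = (cmod (x$1))\<^sup>2 + (cmod (x$2))\<^sup>2"
  by (simp add: norm_vec_def L2_set_def sum_2)

lemma bq_delta: "bq delta w v = of_real ((norm w)\<^sup>2 * (norm v)\<^sup>2)"
  unfolding sform_delta norm_vec_2 sum_2 of_real_mult of_real_add complex_norm_square
  by (simp add: algebra_simps)

text \<open>Expanding the trace and the identity of the second factor along the standard basis
  contracts that factor and leaves a sum of values of \<open>bq c\<close>.\<close>

lemma tform_delta_nonneg: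
  assumes "\<And>w v. bq c w v \<in> \<real>\<^sub>\<ge>\<^sub>0"
  shows "tform c delta w w' v v' \<in> \<real>\<^sub>\<ge>\<^sub>0"
proof -
  have "tform c delta w w' v v' = (\<Sum>a\<in>UNIV. \<Sum>b\<in>UNIV.
      bq c (w' 1 $ a *s w 1 + w' 2 $ a *s w 2) (v' 1 $ b *s v 1 + v' 2 $ b *s v 2))"
    by (simp add: tform_def sform_delta sum_2 sform_add sform_scale algebra_simps)
  also have "\<dots> \<in> \<real>\<^sub>\<ge>\<^sub>0" using assms by (simp add: sum_2)
  finally show ?thesis .
qed

lemma tform_perturbed_nonneg:
  assumes "\<And>w v. bq c w v \<in> \<real>\<^sub>\<ge>\<^sub>0" "\<And>w w' v v'. tform c c w w' v v' \<in> \<real>\<^sub>\<ge>\<^sub>0" "e \<ge> 0"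
  shows "tform (\<lambda>i j k l. 1 * c i j k l + of_real e * delta i j k l) (\<lambda>i j k l. 1 * c i j k l + of_real e * delta i j k l) w w' v v' \<in> \<real>\<^sub>\<ge>\<^sub>0"
proof -
  have "bq delta w v \<in> \<real>\<^sub>\<ge>\<^sub>0" for w v unfolding bq_delta by simp
  then have "tform delta delta w w' v v' \<in> \<real>\<^sub>\<ge>\<^sub>0" by (rule tform_delta_nonneg)
  moreover have "tform c delta w w' v v' \<in> \<real>\<^sub>\<ge>\<^sub>0" "tform delta c w w' v v' \<in> \<real>\<^sub>\<ge>\<^sub>0"
    using tform_delta_nonneg[OF assms(1)] tform_swap by metis+
  ultimately show ?thesis
    using assms unfolding tform_linear by (intro nonneg_Reals_add_I nonneg_Reals_mult_I) auto
qed

text \<open>A positive array is the limit of its sums with \<open>inverse (Suc n)\<close> times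
  \<open>delta\<close>, which satisfy the hypotheses of \<open>core\<close>; the decompositions
  survive the limit. A negative array is replaced by its negative, which has the same tensor
  square.\<close>

lemma tensor_decomposable_if_strict:
  assumes core: "\<And>c e. e > 0 \<Longrightarrow> (\<And>w v. bq c w v \<in> \<real>\<^sub>\<ge>\<^sub>0) \<Longrightarrow>
      (\<And>w v. Re (bq c w v) \<ge> e * ((norm w)\<^sup>2 * (norm v)\<^sup>2)) \<Longrightarrow>
      (\<And>w w' v v'. tform c c w w' v v' \<in> \<real>\<^sub>\<ge>\<^sub>0) \<Longrightarrow> kraus_decomposition 4 N (tens c)"
    and c: "\<And>w w' v v'. tform c c w w' v v' \<in> \<real>\<^sub>\<ge>\<^sub>0"
  shows "kraus_decomposition 4 N (tens c)"
proof -
  have main: "kraus_decomposition 4 N (tens c)"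
    if bq: "\<And>w v. bq c w v \<in> \<real>\<^sub>\<ge>\<^sub>0" and c: "\<And>w w' v v'. tform c c w w' v v' \<in> \<real>\<^sub>\<ge>\<^sub>0" for c
  proof -
    define e where "e n = inverse (real (Suc n))" for n
    define d where "d n = (\<lambda>i j k l. 1 * c i j k l + of_real (e n) * delta i j k l)" for n
    have e: "e n > 0" for n by (simp add: e_def)
    have bqd: "bq (d n) w v = bq c w v + of_real (e n * ((norm w)\<^sup>2 * (norm v)\<^sup>2))" for n w v
      unfolding d_def sform_array_linear bq_delta by simp
    show ?thesis
    proof (rule kraus_decomposition_limit)
      fix n
      show "kraus_decomposition 4 N (tens (d n))"
      proof (rule core[OF e[of n]])
        fix w v
        show "bq (d n) w v \<in> \<real>\<^sub>\<ge>\<^sub>0" "Re (bq (d n) w v) \<ge> e n * ((norm w)\<^sup>2 * (norm v)\<^sup>2)"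
          using bq[of w v] e[of n] by (auto simp: bqd complex_nonneg_Reals_iff)
      next
        fix w w' v v'
        show "tform (d n) (d n) w w' v v' \<in> \<real>\<^sub>\<ge>\<^sub>0"
          unfolding d_def by (rule tform_perturbed_nonneg[OF bq c]) (use e[of n] in simp)
      qed
    next
      fix p q r s
      have "e \<longlonglongrightarrow> 0" unfolding e_def by (rule LIMSEQ_inverse_real_of_nat)
      then have "(\<lambda>n. tens (d n) p q r s) \<longlonglongrightarrow>
         (1 * c (hi p) (hi q) (hi r) (hi s) + of_real 0 * delta (hi p) (hi q) (hi r) (hi s)) *
         (1 * c (lo p) (lo q) (lo r) (lo s) + of_real 0 * delta (lo p) (lo q) (lo r) (lo s))"
        unfolding tens_def d_def by (intro tendsto_intros)
      then show "(\<lambda>n. tens (d n) p q r s) \<longlonglongrightarrow> tens c p q r s"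
        by (simp add: tens_def)
    qed
  qed
  from positive_or_negative_if_tform_nonneg[OF c] show ?thesis
  proof
    assume "\<forall>w v. bq c w v \<in> \<real>\<^sub>\<ge>\<^sub>0"
    then show ?thesis using main c by blast
  next
    assume neg: "\<forall>w v. - bq c w v \<in> \<real>\<^sub>\<ge>\<^sub>0"
    let ?c = "\<lambda>i j k l. - c i j k l"
    have sf: "sform ?c x y v u = - sform c x y v u" for x y v u
      by (simp add: sform_def sum_negf)
    have "kraus_decomposition 4 N (tens ?c)"
      by (rule main) (use neg c in \<open>simp_all add: sf tform_def\<close>)
    moreover have "tens ?c = tens c" by (simp add: tens_def fun_eq_iff)
    ultimately show ?thesis by simp
  qed
qed

section \<open>The Pauli normal form\<close>

text \<open>The weight operator is \<open>8 I \<otimes> I + 4 \<sigma>\<^sub>z \<otimes> \<sigma>\<^sub>z + 2 \<sigma>\<^sub>x \<otimes> \<sigma>\<^sub>x\<close>. It is written as a positive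
  combination of product projections, so that its coercivity is visible, and the
  weights \<open>8, 4, 2, 0\<close> of \<open>I, \<sigma>\<^sub>z, \<sigma>\<^sub>x, \<sigma>\<^sub>y\<close> have distinct squares.\<close>

definition fform :: "(2 \<Rightarrow> 2 \<Rightarrow> 2 \<Rightarrow> 2 \<Rightarrow> complex) \<Rightarrow> (complex^2 \<Rightarrow> complex^2) \<Rightarrow> (complex^2 \<Rightarrow> complex^2) \<Rightarrow>
   (complex^2 \<Rightarrow> complex^2) \<Rightarrow> (complex^2 \<Rightarrow> complex^2) \<Rightarrow> complex" where
  "fform c f f' h h' = (let g = (\<lambda>b a. sform c (f b) (f' b) (h a) (h' a)) in
     2 * g (vec2 1 0) (vec2 0 1) + 2 * g (vec2 0 1) (vec2 1 0)
     + 10 * g (vec2 1 0) (vec2 1 0) + 10 * g (vec2 0 1) (vec2 0 1)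
     + g (vec2 1 1) (vec2 1 1) + g (vec2 1 (-1)) (vec2 1 (-1)))"

section \<open>First variation of the weighted form\<close>

lemma cnj_sform_hermitian:
  assumes "\<And>w v. bq c w v \<in> \<real>"
  shows "cnj (sform c x y v u) = sform c y x u v"
proof -
  have "(\<lambda>i j k l. cnj (c j i l k)) = c"
    by (intro ext) (rule hermitian_if_bq_real[OF assms, symmetric])
  then show ?thesis by (simp add: cnj_sform)
qed

text \<open>The two mixed terms are conjugate because the form is Hermitian, so they add up to twice
  a real part. A complex \<open>t\<close> tests both parts of the derivative.\<close>

lemma fform_perturb_right:
  assumes "\<And>w v. bq c w v \<in> \<real>"
  shows "Re (fform c f f (\<lambda>a. h a + t *s k a) (\<lambda>a. h a + t *s k a)) =
    Re (fform c f f h h) + 2 * Re (t * fform c f f h k) + (cmod t)\<^sup>2 * Re (fform c f f k k)"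
proof -
  have cnj: "cnj (fform c f f h k) = fform c f f k h"
    by (simp add: fform_def Let_def cnj_sform_hermitian[OF assms])
  have "fform c f f (\<lambda>a. h a + t *s k a) (\<lambda>a. h a + t *s k a) =
    fform c f f h h + (t * fform c f f h k + cnj t * fform c f f k h) + t * cnj t * fform c f f k k"
    by (simp add: fform_def Let_def sform_add sform_scale algebra_simps)
  also have "\<dots> = fform c f f h h + (t * fform c f f h k + cnj (t * fform c f f h k))
      + of_real ((cmod t)\<^sup>2) * fform c f f k k"
    by (simp only: complex_norm_square flip: cnj) simp
  finally show ?thesis by (simp del: of_real_power)
qed

lemma fform_perturb_left:
  assumes "\<And>w v. bq c w v \<in> \<real>"
  shows "Re (fform c (\<lambda>a. f a + t *s k a) (\<lambda>a. f a + t *s k a) h h) =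
    Re (fform c f f h h) + 2 * Re (t * fform c k f h h) + (cmod t)\<^sup>2 * Re (fform c k k h h)"
proof -
  have cnj: "cnj (fform c k f h h) = fform c f k h h"
    by (simp add: fform_def Let_def cnj_sform_hermitian[OF assms])
  have "fform c (\<lambda>a. f a + t *s k a) (\<lambda>a. f a + t *s k a) h h =
    fform c f f h h + (t * fform c k f h h + cnj t * fform c f k h h) + t * cnj t * fform c k k h h"
    by (simp add: fform_def Let_def sform_add sform_scale algebra_simps)
  also have "\<dots> = fform c f f h h + (t * fform c k f h h + cnj (t * fform c k f h h))
      + of_real ((cmod t)\<^sup>2) * fform c k k h h"
    by (simp only: complex_norm_square flip: cnj) simp
  finally show ?thesis by (simp del: of_real_power)
qed

text \<open>The bound \<open>f * (1 - |t|\<^sup>2)\<close> is what \<open>|det (I + t K)| \<ge> 1 - |t|\<^sup>2\<close> provides for traceless \<open>K\<close> with \<open>|det K| \<le> 1\<close>.\<close>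

lemma first_order_zero:
  assumes "\<And>t :: complex. f + 2 * Re (t * L) + (cmod t)\<^sup>2 * g \<ge> f * (1 - (cmod t)\<^sup>2)"
  shows "L = 0"
proof (rule ccontr)
  assume L: "L \<noteq> 0"
  \<comment> \<open>The test value of \<open>t\<close> is \<open>- s * cnj L\<close>, a step against
    the gradient, and \<open>s\<close> is small enough that the quadratic terms cannot outweigh the
    linear one.\<close>
  define s where "s = 1 / (1 + \<bar>f + g\<bar>)"
  have s: "s > 0" by (simp add: s_def)
  have "s * (f + g) < 1"
    unfolding s_def by (simp add: divide_less_eq abs_if)
  have m: "Re (- (of_real s * cnj L) * L) = - s * (cmod L)\<^sup>2"
    by (simp add: cmod_def power2_eq_square algebra_simps)
  have n: "(cmod (- (of_real s * cnj L)))\<^sup>2 = s\<^sup>2 * (cmod L)\<^sup>2"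
    by (simp add: norm_mult power_mult_distrib)
  have "0 \<le> - 2 * s * (cmod L)\<^sup>2 + s\<^sup>2 * (cmod L)\<^sup>2 * (f + g)"
    using assms[of "- (of_real s * cnj L)"] unfolding m n by (simp add: algebra_simps)
  also have "\<dots> = (s * (cmod L)\<^sup>2) * (s * (f + g) - 2)"
    by (simp add: algebra_simps power2_eq_square)
  also have "\<dots> < 0"
    using s L \<open>s * (f + g) < 1\<close> by (intro mult_pos_neg) auto
  finally show False by simp
qed

definition mat2 :: "complex \<Rightarrow> complex \<Rightarrow> complex \<Rightarrow> complex \<Rightarrow> complex^2^2" where
  "mat2 a b c d = (\<chi> i j. if i = 1 then (if j = 1 then a else b) else (if j = 1 then c else d))"

lemma mat2_simps [simp]: "mat2 a b c d $ 1 $ 1 = a" "mat2 a b c d $ 1 $ 2 = b" "mat2 a b c d $ 2 $ 1 = c" "mat2 a b c d $ 2 $ 2 = d"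
  by (simp_all add: mat2_def)

lemma mat2_mult_vec: "mat2 a b c d *v x = vec2 (a * x$1 + b * x$2) (c * x$1 + d * x$2)"
  by (simp add: vec_eq_iff forall_2 matrix_vector_mult_def sum_2)

lemma matrix_vector_mult_2: "A *v x = vec2 (A$1$1 * x$1 + A$1$2 * x$2) (A$2$1 * x$1 + A$2$2 * x$2)" for A :: "complex^2^2"
  by (simp add: vec_eq_iff forall_2 matrix_vector_mult_def sum_2)

text \<open>\<open>right\<close> and \<open>left\<close> say that the identity is optimal on either
  side, relative to the determinant. Varying along I + t K with K traceless makes six first-order
  coefficients vanish, and these linear equations force the Pauli form.\<close>

lemma pauli_entries_of_stationary:
  assumes re: "\<And>w v. bq c w v \<in> \<real>"
    and right: "\<And>G. Re (fform c (\<lambda>x. x) (\<lambda>x. x) ((*v) G) ((*v) G)) \<ge> f * cmod (det G)"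
    and left: "\<And>G. Re (fform c ((*v) G) ((*v) G) (\<lambda>x. x) (\<lambda>x. x)) \<ge> f * cmod (det G)"
    and f: "f = Re (fform c (\<lambda>x. x) (\<lambda>x. x) (\<lambda>x. x) (\<lambda>x. x))" "f > 0"
  shows "c 1 1 1 2 = 0" "c 2 2 1 2 = 0" "c 1 2 1 1 = 0" "c 1 2 2 2 = 0"
    "c 1 1 1 1 = c 2 2 2 2" "c 1 1 2 2 = c 2 2 1 1" "Im (c 1 2 1 2) = 0" "Im (c 1 2 2 1) = 0"
proof -
  have dets: "cmod (det (mat2 (1 + t * a) (t * b) (t * d) (1 - t * a))) \<ge> 1 - (cmod t)\<^sup>2"
    if "cmod (a * a + b * d) \<le> 1" for t a b d
  proof -
    have "det (mat2 (1 + t * a) (t * b) (t * d) (1 - t * a)) = 1 - t\<^sup>2 * (a * a + b * d)"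
      by (simp add: det_2 algebra_simps power2_eq_square)
    moreover have "cmod (t\<^sup>2 * (a * a + b * d)) \<le> (cmod t)\<^sup>2"
      using that by (simp add: norm_mult norm_power mult_left_le)
    moreover have "cmod 1 - cmod (t\<^sup>2 * (a * a + b * d)) \<le> cmod (1 - t\<^sup>2 * (a * a + b * d))"
      by (rule norm_triangle_ineq2)
    ultimately show ?thesis by simp
  qed
  let ?K = "\<lambda>a b d x. mat2 a b d (- a) *v x"
  have K: "mat2 (1 + t * a) (t * b) (t * d) (1 - t * a) *v x = x + t *s ?K a b d x" for t a b d x
    by (simp add: mat2_mult_vec vec_eq_iff forall_2 algebra_simps)
  have R: "fform c (\<lambda>x. x) (\<lambda>x. x) (\<lambda>x. x) (?K a b d) = 0" if "cmod (a * a + b * d) \<le> 1" for a b d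
  proof (rule first_order_zero)
    fix t
    have "f * (1 - (cmod t)\<^sup>2) \<le> f * cmod (det (mat2 (1 + t * a) (t * b) (t * d) (1 - t * a)))"
      using f(2) by (intro mult_left_mono dets that) auto
    also have "\<dots> \<le> Re (fform c (\<lambda>x. x) (\<lambda>x. x) ((*v) (mat2 (1 + t * a) (t * b) (t * d) (1 - t * a))) ((*v) (mat2 (1 + t * a) (t * b) (t * d) (1 - t * a))))"
      by (rule right)
    also have "\<dots> = f + 2 * Re (t * fform c (\<lambda>x. x) (\<lambda>x. x) (\<lambda>x. x) (?K a b d)) + (cmod t)\<^sup>2 * Re (fform c (\<lambda>x. x) (\<lambda>x. x) (?K a b d) (?K a b d))"
      unfolding K fform_perturb_right[OF re] f(1) ..
    finally show "f * (1 - (cmod t)\<^sup>2) \<le> f + 2 * Re (t * fform c (\<lambda>x. x) (\<lambda>x. x) (\<lambda>x. x) (?K a b d)) + (cmod t)\<^sup>2 * Re (fform c (\<lambda>x. x) (\<lambda>x. x) (?K a b d) (?K a b d))" .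
  qed
  have L: "fform c (?K a b d) (\<lambda>x. x) (\<lambda>x. x) (\<lambda>x. x) = 0" if "cmod (a * a + b * d) \<le> 1" for a b d
  proof (rule first_order_zero)
    fix t
    have "f * (1 - (cmod t)\<^sup>2) \<le> f * cmod (det (mat2 (1 + t * a) (t * b) (t * d) (1 - t * a)))"
      using f(2) by (intro mult_left_mono dets that) auto
    also have "\<dots> \<le> Re (fform c ((*v) (mat2 (1 + t * a) (t * b) (t * d) (1 - t * a))) ((*v) (mat2 (1 + t * a) (t * b) (t * d) (1 - t * a))) (\<lambda>x. x) (\<lambda>x. x))"
      by (rule left)
    also have "\<dots> = f + 2 * Re (t * fform c (?K a b d) (\<lambda>x. x) (\<lambda>x. x) (\<lambda>x. x)) + (cmod t)\<^sup>2 * Re (fform c (?K a b d) (?K a b d) (\<lambda>x. x) (\<lambda>x. x))"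
      unfolding K fform_perturb_left[OF re] f(1) ..
    finally show "f * (1 - (cmod t)\<^sup>2) \<le> f + 2 * Re (t * fform c (?K a b d) (\<lambda>x. x) (\<lambda>x. x) (\<lambda>x. x)) + (cmod t)\<^sup>2 * Re (fform c (?K a b d) (?K a b d) (\<lambda>x. x) (\<lambda>x. x))" .
  qed
  note herm = hermitian_if_bq_real[OF re]
  \<comment> \<open>The directions K are \<sigma>\<open>\<^sub>z\<close> and the two off-diagonal
    matrix units, a basis of the traceless matrices, taken on the output and then on the input
    side.\<close>
  have F:
    "fform c (\<lambda>x. x) (\<lambda>x. x) (\<lambda>x. x) (?K 1 0 0)
      = 12 * c 1 1 1 1 + 4 * c 2 2 1 1 - 4 * c 1 1 2 2 - 12 * c 2 2 2 2 + 2 * c 1 2 2 1 + 2 * c 2 1 2 1 - 2 * c 1 2 1 2 - 2 * c 2 1 1 2"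
    "fform c (\<lambda>x. x) (\<lambda>x. x) (\<lambda>x. x) (?K 0 1 0)
      = 4 * c 1 1 2 1 + 12 * c 2 2 2 1 + 2 * c 1 2 1 1 + 2 * c 2 1 1 1"
    "fform c (\<lambda>x. x) (\<lambda>x. x) (\<lambda>x. x) (?K 0 0 1)
      = 12 * c 1 1 1 2 + 4 * c 2 2 1 2 + 2 * c 1 2 2 2 + 2 * c 2 1 2 2"
    "fform c (?K 1 0 0) (\<lambda>x. x) (\<lambda>x. x) (\<lambda>x. x)
      = 12 * c 1 1 1 1 + 4 * c 1 1 2 2 - 4 * c 2 2 1 1 - 12 * c 2 2 2 2 + 2 * c 1 2 1 2 + 2 * c 1 2 2 1 - 2 * c 2 1 1 2 - 2 * c 2 1 2 1"
    "fform c (?K 0 1 0) (\<lambda>x. x) (\<lambda>x. x) (\<lambda>x. x)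
      = 4 * c 1 2 1 1 + 12 * c 1 2 2 2 + 2 * c 1 1 1 2 + 2 * c 1 1 2 1"
    "fform c (?K 0 0 1) (\<lambda>x. x) (\<lambda>x. x) (\<lambda>x. x)
      = 12 * c 2 1 1 1 + 4 * c 2 1 2 2 + 2 * c 2 2 1 2 + 2 * c 2 2 2 1"
    by (simp_all add: fform_def sform_def sum_2 mat2_mult_vec algebra_simps)
  have Z:
    "fform c (\<lambda>x. x) (\<lambda>x. x) (\<lambda>x. x) (?K 1 0 0) = 0"
    "fform c (\<lambda>x. x) (\<lambda>x. x) (\<lambda>x. x) (?K 0 1 0) = 0"
    "fform c (\<lambda>x. x) (\<lambda>x. x) (\<lambda>x. x) (?K 0 0 1) = 0"
    "fform c (?K 1 0 0) (\<lambda>x. x) (\<lambda>x. x) (\<lambda>x. x) = 0"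
    "fform c (?K 0 1 0) (\<lambda>x. x) (\<lambda>x. x) (\<lambda>x. x) = 0"
    "fform c (?K 0 0 1) (\<lambda>x. x) (\<lambda>x. x) (\<lambda>x. x) = 0"
    by (rule R L; simp)+
  note E = Z(1)[unfolded F(1)] Z(2)[unfolded F(2)] Z(3)[unfolded F(3)] Z(4)[unfolded F(4)] Z(5)[unfolded F(5)] Z(6)[unfolded F(6)]
  have reals: "Im (c i i k k) = 0" for i k
    using arg_cong[OF herm[of i i k k], of Im] by simp
  have conj: "c 1 1 2 1 = cnj (c 1 1 1 2)" "c 2 2 2 1 = cnj (c 2 2 1 2)" "c 2 1 1 1 = cnj (c 1 2 1 1)"
     "c 2 1 2 2 = cnj (c 1 2 2 2)" "c 2 1 2 1 = cnj (c 1 2 1 2)" "c 2 1 1 2 = cnj (c 1 2 2 1)"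
    by (rule herm)+
  have re_im: "Re z = 0" "Im z = 0" if "z = 0" for z using that by simp_all
  note lin = E[unfolded conj, THEN re_im(1)] E[unfolded conj, THEN re_im(2)]
  note lin = lin[unfolded plus_complex.sel minus_complex.sel times_complex.sel complex_cnj complex_Re_numeral complex_Im_numeral mult_zero_left diff_0_right add_0_left add_0_right diff_zero cnj.sel]
    reals[of 1 1] reals[of 1 2] reals[of 2 1] reals[of 2 2]
  \<comment> \<open>In Pauli coordinates the equations decouple into pairs relating two mirrored
    off-diagonal entries, with the two weights interchanged. Up to a nonzero factor the determinant
    of a pair is the difference of the squared weights.\<close>
  have "Re (c 1 1 1 2) = 0" "Im (c 1 1 1 2) = 0" "Re (c 2 2 1 2) = 0" "Im (c 2 2 1 2) = 0"
    "Re (c 1 2 1 1) = 0" "Im (c 1 2 1 1) = 0" "Re (c 1 2 2 2) = 0" "Im (c 1 2 2 2) = 0"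
    using lin(2-3) lin(5-6) lin(8-9) lin(11-12) by linarith+
  moreover have "Re (c 1 1 1 1) = Re (c 2 2 2 2)" "Re (c 1 1 2 2) = Re (c 2 2 1 1)"
    using lin(1) lin(4) by linarith+
  ultimately show "c 1 1 1 2 = 0" "c 2 2 1 2 = 0" "c 1 2 1 1 = 0" "c 1 2 2 2 = 0"
    "c 1 1 1 1 = c 2 2 2 2" "c 1 1 2 2 = c 2 2 1 1"
    using reals by (simp_all only: complex_eq_iff zero_complex.sel)
  show "Im (c 1 2 1 2) = 0" "Im (c 1 2 2 1) = 0"
    using lin(7) lin(10) reals[of 1 1] reals[of 1 2] reals[of 2 1] reals[of 2 2] by linarith+
qed

text \<open>The array of X \<mapsto> A* P(B X B*\<open>)\<close> A when \<open>c\<close> is that of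
  P.\<close>

definition transf :: "(2 \<Rightarrow> 2 \<Rightarrow> 2 \<Rightarrow> 2 \<Rightarrow> complex) \<Rightarrow> complex^2^2 \<Rightarrow> complex^2^2 \<Rightarrow> 2 \<Rightarrow> 2 \<Rightarrow> 2 \<Rightarrow> 2 \<Rightarrow> complex" where
  "transf c A B i j k l = sform c (B *v axis i 1) (B *v axis j 1) (A *v axis k 1) (A *v axis l 1)"

lemma sform_transf:
  "sform (transf c A B) x y v u = sform c (B *v x) (B *v y) (A *v v) (A *v u)"
proof -
  define a b where "a i = A *v axis i 1" and "b i = B *v axis i 1" for i
  have "A *v z = z$1 *s a 1 + z$2 *s a 2" "B *v z = z$1 *s b 1 + z$2 *s b 2" for z
    by (simp_all add: a_def b_def vec_eq_iff matrix_vector_mult_def sum_2 axis_def algebra_simps)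
  moreover have "transf c A B i j k l = sform c (b i) (b j) (a k) (a l)" for i j k l
    by (simp add: transf_def a_def b_def)
  ultimately show ?thesis
    by (simp add: sform_add sform_scale) (simp add: sform_def[of "transf c A B"] sum_2 algebra_simps)
qed

lemma tform_transf:
  "tform (transf c A B) (transf c A B) w w' v v' =
   tform c c (\<lambda>x. B *v w x) (\<lambda>x. B *v w' x) (\<lambda>x. A *v v x) (\<lambda>x. A *v v' x)"
  by (simp add: tform_def sform_transf)

section \<open>Existence of a minimiser with unit determinants\<close>

lemma norm_mat_2: "(norm (A :: complex^2^2))\<^sup>2 =
    (cmod (A$1$1))\<^sup>2 + (cmod (A$1$2))\<^sup>2 + (cmod (A$2$1))\<^sup>2 + (cmod (A$2$2))\<^sup>2"
  by (simp add: norm_vec_def[of A] L2_set_def sum_2 norm_vec_2)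

text \<open>The arithmetic-geometric mean inequality on both products of the determinant. It keeps
  the norm of a matrix of determinant 1 away from zero.\<close>

lemma norm_det_le: "2 * cmod (det (A :: complex^2^2)) \<le> (norm A)\<^sup>2"
proof -
  have *: "2 * (x * y) \<le> x\<^sup>2 + y\<^sup>2" for x y :: real
    using sum_squares_bound[of x y] by (simp add: mult.assoc)
  have "cmod (det A) \<le> cmod (A$1$1 * A$2$2) + cmod (A$1$2 * A$2$1)"
    unfolding det_2 by (rule norm_triangle_ineq4)
  then show ?thesis
    using *[of "cmod (A$1$1)" "cmod (A$2$2)"] *[of "cmod (A$1$2)" "cmod (A$2$1)"]
    unfolding norm_mat_2 norm_mult by linarith
qed

abbreviation energy :: "(2 \<Rightarrow> 2 \<Rightarrow> 2 \<Rightarrow> 2 \<Rightarrow> complex) \<Rightarrow> complex^2^2 \<Rightarrow> complex^2^2 \<Rightarrow> real" where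
  "energy c A B \<equiv> Re (fform c ((*v) B) ((*v) B) ((*v) A) ((*v) A))"

text \<open>Keep each pair of standard basis vectors once and drop the remaining nonnegative terms.
  The squared column norms then add up to the squared Frobenius norms.\<close>

lemma energy_lower_bound:
  assumes pos: "\<And>w v. bq c w v \<in> \<real>\<^sub>\<ge>\<^sub>0"
    and strict: "\<And>w v. Re (bq c w v) \<ge> e * ((norm w)\<^sup>2 * (norm v)\<^sup>2)"
  shows "energy c A B \<ge> e * ((norm A)\<^sup>2 * (norm B)\<^sup>2)"
proof -
  have p: "Re (bq c w v) \<ge> 0" for w v using pos[of w v] by (simp add: complex_nonneg_Reals_iff)
  let ?g = "\<lambda>b a. Re (bq c (B *v b) (A *v a))"
  let ?n = "\<lambda>b a. e * ((norm (B *v b))\<^sup>2 * (norm (A *v a))\<^sup>2)"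
  have "energy c A B \<ge> ?g (vec2 1 0) (vec2 0 1) + ?g (vec2 0 1) (vec2 1 0) + ?g (vec2 1 0) (vec2 1 0) + ?g (vec2 0 1) (vec2 0 1)"
    using p[of "B *v vec2 1 0" "A *v vec2 0 1"] p[of "B *v vec2 0 1" "A *v vec2 1 0"]
      p[of "B *v vec2 1 0" "A *v vec2 1 0"] p[of "B *v vec2 0 1" "A *v vec2 0 1"]
      p[of "B *v vec2 1 1" "A *v vec2 1 1"] p[of "B *v vec2 1 (-1)" "A *v vec2 1 (-1)"]
    by (simp add: fform_def Let_def)
  also have "?g (vec2 1 0) (vec2 0 1) + ?g (vec2 0 1) (vec2 1 0) + ?g (vec2 1 0) (vec2 1 0) + ?g (vec2 0 1) (vec2 0 1)
    \<ge> ?n (vec2 1 0) (vec2 0 1) + ?n (vec2 0 1) (vec2 1 0) + ?n (vec2 1 0) (vec2 1 0) + ?n (vec2 0 1) (vec2 0 1)"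
    by (intro add_mono strict)
  also have "?n (vec2 1 0) (vec2 0 1) + ?n (vec2 0 1) (vec2 1 0) + ?n (vec2 1 0) (vec2 1 0) + ?n (vec2 0 1) (vec2 0 1)
    = e * ((norm A)\<^sup>2 * (norm B)\<^sup>2)"
    by (simp add: matrix_vector_mult_2 norm_vec_2 norm_mat_2 algebra_simps)
  finally show ?thesis .
qed

lemma continuous_on_matrix_vector_mult_left [continuous_intros]:
  fixes f :: "'a::topological_space \<Rightarrow> complex^2^2"
  assumes "continuous_on S f" shows "continuous_on S (\<lambda>z. f z *v a)"
  unfolding matrix_vector_mult_def using assms by (intro continuous_intros)

lemma continuous_on_sform [continuous_intros]:
  assumes "continuous_on S x" "continuous_on S y" "continuous_on S v" "continuous_on S u"
  shows "continuous_on S (\<lambda>z. sform c (x z) (y z) (v z) (u z))"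
  unfolding sform_def using assms by (intro continuous_intros)

text \<open>Coercivity: if one matrix leaves the ball of radius \<open>R\<close>, the other still
  has norm at least 1, so the energy is at least its value at the identity pair. A minimum over the
  compact part is therefore global.\<close>

lemma energy_minimizer:
  assumes e: "e > 0" and pos: "\<And>w v. bq c w v \<in> \<real>\<^sub>\<ge>\<^sub>0"
    and strict: "\<And>w v. Re (bq c w v) \<ge> e * ((norm w)\<^sup>2 * (norm v)\<^sup>2)"
  obtains A B where "det A = 1" "det B = 1" 
    "\<And>A' B'. det A' = 1 \<Longrightarrow> det B' = 1 \<Longrightarrow> energy c A B \<le> energy c A' B'"
proof -
  define f0 where "f0 = energy c (mat 1) (mat 1)"
  have f0: "f0 \<ge> 0"
    unfolding f0_def by (rule order.trans[OF _ energy_lower_bound[OF pos strict]]) (use e in simp)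
  \<comment> \<open>The summand 2 puts the identity into the ball and makes squares of numbers above
    \<open>R\<close> exceed \<open>R\<close>; the summand \<open>f0 / e\<close> gives
    \<open>e * R \<ge> f0\<close>.\<close>
  define R where "R = 2 + f0 / e"
  have R: "R \<ge> 2" "e * R \<ge> f0" using e f0 by (simp_all add: R_def field_simps)
  define K where "K = {A :: complex^2^2. det A = 1} \<inter> cball 0 R"
  have "closed {A :: complex^2^2. det A = 1}"
    unfolding det_2 by (intro closed_Collect_eq continuous_intros)
  then have "compact (K \<times> K)" unfolding K_def by (intro compact_Times closed_Int_compact) auto
  moreover have one: "mat 1 \<in> K"
  proof -
    have "(norm (mat 1 :: complex^2^2))\<^sup>2 \<le> R\<^sup>2"
      using power_mono[OF R(1), of 2] by (simp add: norm_mat_2 mat_def)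
    then have "norm (mat 1 :: complex^2^2) \<le> R"
      by (rule power2_le_imp_le) (use R in simp)
    then show ?thesis by (simp add: K_def)
  qed
  moreover have "continuous_on (K \<times> K) (\<lambda>z. energy c (fst z) (snd z))"
    unfolding fform_def Let_def by (intro continuous_intros)
  ultimately obtain z where z: "z \<in> K \<times> K" and min: "\<And>y. y \<in> K \<times> K \<Longrightarrow> energy c (fst z) (snd z) \<le> energy c (fst y) (snd y)"
    using continuous_attains_inf[of "K \<times> K" "\<lambda>z. energy c (fst z) (snd z)"] by blast
  show thesis
  proof
    show "det (fst z) = 1" "det (snd z) = 1" using z by (auto simp: K_def)
  next
    fix A B :: "complex^2^2" assume AB: "det A = 1" "det B = 1"
    show "energy c (fst z) (snd z) \<le> energy c A B"
    proof (cases "norm A \<le> R \<and> norm B \<le> R")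
      case True
      then show ?thesis using min[of "(A,B)"] AB by (simp add: K_def)
    next
      case False
      have ge: "(norm A)\<^sup>2 \<ge> 1" "(norm B)\<^sup>2 \<ge> 1" using norm_det_le[of A] norm_det_le[of B] AB by simp_all
      have big: "R \<le> x\<^sup>2" if "\<not> x \<le> R" for x
      proof -
        have "R * 1 \<le> x * x" using that R by (intro mult_mono) auto
        then show ?thesis by (simp add: power2_eq_square)
      qed
      have "R \<le> (norm A)\<^sup>2 * (norm B)\<^sup>2"
      proof (cases "norm A \<le> R")
        case True
        then have "1 * R \<le> (norm A)\<^sup>2 * (norm B)\<^sup>2" using False R ge by (intro mult_mono big) auto
        then show ?thesis by simp
      next
        case F: False
        then have "R * 1 \<le> (norm A)\<^sup>2 * (norm B)\<^sup>2" using R ge by (intro mult_mono big) auto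
        then show ?thesis by simp
      qed
      then have "f0 \<le> e * ((norm A)\<^sup>2 * (norm B)\<^sup>2)"
        using R(2) e by (meson mult_left_mono order.trans less_imp_le)
      also have "\<dots> \<le> energy c A B" by (rule energy_lower_bound[OF pos strict])
      finally have "f0 \<le> energy c A B" .
      then show ?thesis using min[of "(mat 1, mat 1)"] one by (simp add: f0_def)
    qed
  qed
qed

lemma unit_det_scaling:
  fixes A :: "complex^2^2"
  assumes "det A \<noteq> 0"
  obtains s A' where "det A' = 1" "\<And>x. A *v x = s *s (A' *v x)" "(cmod s)\<^sup>2 = cmod (det A)"
proof -
  define s where "s = csqrt (det A)"
  have s2: "s * s = det A" unfolding s_def by (simp flip: power2_eq_square)
  with assms have s0: "s \<noteq> 0" by auto
  show thesis
  proof
    show "det (mat2 (A$1$1/s) (A$1$2/s) (A$2$1/s) (A$2$2/s)) = 1"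
      using s0 assms s2 by (simp add: det_2 diff_divide_distrib[symmetric])
    show "A *v x = s *s (mat2 (A$1$1/s) (A$1$2/s) (A$2$1/s) (A$2$2/s) *v x)" for x
      using s0 by (simp add: matrix_vector_mult_2[of A] mat2_mult_vec vec_eq_iff forall_2 algebra_simps)
    show "(cmod s)\<^sup>2 = cmod (det A)" unfolding s2[symmetric] norm_mult power2_eq_square ..
  qed
qed

lemma fform_scale:
  "fform c f f (\<lambda>x. s *s h x) (\<lambda>x. s *s h x) = of_real ((cmod s)\<^sup>2) * fform c f f h h"
  "fform c (\<lambda>x. s *s f x) (\<lambda>x. s *s f x) h h = of_real ((cmod s)\<^sup>2) * fform c f f h h"
  unfolding complex_norm_square by (simp_all add: fform_def Let_def sform_scale algebra_simps)

text \<open>The energy is homogeneous: rescaling to determinant 1 divides it by the modulus of the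
  determinant. This trades the constraint for an inequality over all matrices; singular ones only
  need nonnegativity.\<close>

lemma energy_minimizer_det:
  assumes pos: "\<And>w v. bq c w v \<in> \<real>\<^sub>\<ge>\<^sub>0"
    and min: "\<And>A' B'. det A' = 1 \<Longrightarrow> det B' = 1 \<Longrightarrow> f \<le> energy c A' B'"
  shows "det B = 1 \<Longrightarrow> f * cmod (det A) \<le> energy c A B" "det A = 1 \<Longrightarrow> f * cmod (det B) \<le> energy c A B"
proof -
  have nonneg: "energy c A B \<ge> 0" for A B
    using energy_lower_bound[of c 0 A B] pos by (simp add: complex_nonneg_Reals_iff)
  show "f * cmod (det A) \<le> energy c A B" if "det B = 1"
  proof (cases "det A = 0")
    case False
    then obtain s A' where A': "det A' = 1" "\<And>x. A *v x = s *s (A' *v x)" and s: "(cmod s)\<^sup>2 = cmod (det A)"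
      using unit_det_scaling by metis
    have "(*v) A = (\<lambda>x. s *s (A' *v x))" using A'(2) by (rule ext)
    then have "energy c A B = cmod (det A) * energy c A' B"
      by (simp add: fform_scale(1) s del: of_real_power)
    then show ?thesis using mult_left_mono[OF min[OF A'(1) that], of "cmod (det A)"] by (simp add: mult.commute)
  qed (use nonneg in simp)
  show "f * cmod (det B) \<le> energy c A B" if "det A = 1"
  proof (cases "det B = 0")
    case False
    then obtain s B' where B': "det B' = 1" "\<And>x. B *v x = s *s (B' *v x)" and s: "(cmod s)\<^sup>2 = cmod (det B)"
      using unit_det_scaling by metis
    have "(*v) B = (\<lambda>x. s *s (B' *v x))" using B'(2) by (rule ext)
    then have "energy c A B = cmod (det B) * energy c A B'"
      by (simp add: fform_scale(2) s del: of_real_power)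
    then show ?thesis using mult_left_mono[OF min[OF that B'(1)], of "cmod (det B)"] by (simp add: mult.commute)
  qed (use nonneg in simp)
qed

text \<open>The array of the Pauli diagonal map with \<open>a = q\<^sub>0 + q\<^sub>1\<close>,
  \<open>g = q\<^sub>0 - q\<^sub>1\<close>, \<open>b = q\<^sub>2 + q\<^sub>3\<close> and
  \<open>d = q\<^sub>2 - q\<^sub>3\<close>.\<close>

definition pauli_array :: "real \<Rightarrow> real \<Rightarrow> real \<Rightarrow> real \<Rightarrow> 2 \<Rightarrow> 2 \<Rightarrow> 2 \<Rightarrow> 2 \<Rightarrow> complex" where
  "pauli_array a b g d i j k l =
     (if i = j \<and> k = l then (if i = k then of_real a else of_real b)
      else if i \<noteq> j \<and> k \<noteq> l then (if i = k then of_real g else of_real d) else 0)"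

text \<open>Absorbing a minimiser \<open>A\<close>, \<open>B\<close> into the array makes the
  identity optimal, since multiplying by \<open>A\<close> or \<open>B\<close> preserves
  determinants. Strictness and invertibility make the diagonal entries positive.\<close>

lemma pauli_normal_form:
  assumes e: "e > 0" and pos: "\<And>w v. bq c w v \<in> \<real>\<^sub>\<ge>\<^sub>0"
    and strict: "\<And>w v. Re (bq c w v) \<ge> e * ((norm w)\<^sup>2 * (norm v)\<^sup>2)"
  obtains A B a b g d where "det A = 1" "det B = 1" "a > 0" "b > 0" "transf c A B = pauli_array a b g d"
proof -
  obtain A B where AB: "det A = 1" "det B = 1"
    and min: "\<And>A' B'. det A' = 1 \<Longrightarrow> det B' = 1 \<Longrightarrow> energy c A B \<le> energy c A' B'"
    using energy_minimizer[OF e pos strict] by metis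
  define t where "t = transf c A B"
  have t: "sform t x y v u = sform c (B *v x) (B *v y) (A *v v) (A *v u)" for x y v u
    unfolding t_def by (rule sform_transf)
  have re: "bq t w v \<in> \<real>" for w v
    using pos[of "B *v w" "A *v v"] by (auto simp: t nonneg_Reals_def)
  have ft: "fform t f f' h h' = fform c (\<lambda>x. B *v f x) (\<lambda>x. B *v f' x) (\<lambda>x. A *v h x) (\<lambda>x. A *v h' x)" for f f' h h'
    by (simp add: fform_def t)
  define E where "E = energy c A B"
  have en: "E = Re (fform t (\<lambda>x. x) (\<lambda>x. x) (\<lambda>x. x) (\<lambda>x. x))"
    by (simp add: ft E_def)
  have nz: "norm A > 0" "norm B > 0" using AB norm_det_le[of A] norm_det_le[of B] by auto
  then have "0 < e * ((norm A)\<^sup>2 * (norm B)\<^sup>2)" using e by simp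
  moreover have "e * ((norm A)\<^sup>2 * (norm B)\<^sup>2) \<le> E"
    unfolding E_def by (rule energy_lower_bound[OF pos strict])
  ultimately have fpos: "E > 0" by linarith
  have min': "E \<le> energy c A' B'" if "det A' = 1" "det B' = 1" for A' B'
    unfolding E_def by (rule min[OF that])
  have R: "E * cmod (det G) \<le> Re (fform t (\<lambda>x. x) (\<lambda>x. x) ((*v) G) ((*v) G))" for G
  proof -
    have "E * cmod (det (A ** G)) \<le> energy c (A ** G) B"
      by (rule energy_minimizer_det(1)[OF pos min' AB(2)])
    then show ?thesis using AB by (simp add: ft det_mul matrix_vector_mul_assoc)
  qed
  have L: "E * cmod (det G) \<le> Re (fform t ((*v) G) ((*v) G) (\<lambda>x. x) (\<lambda>x. x))" for G
  proof -
    have "E * cmod (det (B ** G)) \<le> energy c A (B ** G)"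
      by (rule energy_minimizer_det(2)[OF pos min' AB(1)])
    then show ?thesis using AB by (simp add: ft det_mul matrix_vector_mul_assoc)
  qed
  note S = pauli_entries_of_stationary[where c = t and f = E, OF re R L en fpos]
  note herm = hermitian_if_bq_real[OF re]
  have nzv: "M *v x \<noteq> 0" if "det M = 1" "x \<noteq> 0" for M :: "complex^2^2" and x
    using that by (metis invertible_det_nz matrix_left_invertible_ker invertible_def zero_neq_one)
  have diag: "Re (t i i k k) > 0" "Im (t i i k k) = 0" for i k
  proof -
    let ?w = "axis i 1 :: complex^2" and ?v = "axis k 1 :: complex^2"
    have tt: "t i i k k = bq c (B *v ?w) (A *v ?v)" by (simp add: t_def transf_def)
    have "0 < e * ((norm (B *v ?w))\<^sup>2 * (norm (A *v ?v))\<^sup>2)"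
      using e nzv AB by (simp add: axis_eq_0_iff)
    also have "\<dots> \<le> Re (t i i k k)" unfolding tt by (rule strict)
    finally show "Re (t i i k k) > 0" .
    show "Im (t i i k k) = 0" using pos[of "B *v ?w" "A *v ?v"] by (simp add: tt complex_nonneg_Reals_iff)
  qed
  have "t i j k l = pauli_array (Re (t 1 1 1 1)) (Re (t 1 1 2 2)) (Re (t 1 2 1 2)) (Re (t 1 2 2 1)) i j k l" for i j k l
  proof -
    have 1: "t 1 1 2 1 = cnj (t 1 1 1 2)" "t 2 2 2 1 = cnj (t 2 2 1 2)" "t 2 1 1 1 = cnj (t 1 2 1 1)"
     "t 2 1 2 2 = cnj (t 1 2 2 2)" "t 2 1 2 1 = cnj (t 1 2 1 2)" "t 2 1 1 2 = cnj (t 1 2 2 1)"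
      by (rule herm)+
    have 2: "of_real (Re z) = z" "cnj z = z" if "Im z = 0" for z
      using that by (simp_all add: complex_eq_iff)
    have "i = 1 \<or> i = 2" "j = 1 \<or> j = 2" "k = 1 \<or> k = 2" "l = 1 \<or> l = 2" by (rule exhaust_2)+
    then show ?thesis
      by (elim disjE) (simp_all add: pauli_array_def 1 S 2 diag)
  qed
  then show thesis
    using that[OF AB diag(1)[of 1 1] diag(1)[of 1 2]] unfolding t_def by blast
qed

text \<open>The input is the unnormalised Bell vector, the sum of the e \<otimes> e over the
  standard basis; the outputs tested are the other three Bell vectors. In terms of the weights
  \<open>q\<close> the results are \<open>q\<^sub>0 q\<^sub>1 + q\<^sub>2 q\<^sub>3 \<ge> 0\<close>
  and its two analogues.\<close>

lemma pauli_array_tensor_conditions: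
  assumes t: "\<And>w w' v v'. tform (pauli_array a b g d) (pauli_array a b g d) w w' v v' \<in> \<real>\<^sub>\<ge>\<^sub>0"
  shows "a\<^sup>2 + b\<^sup>2 \<ge> g\<^sup>2 + d\<^sup>2" "a * b + g * d \<ge> 0" "a * b - g * d \<ge> 0"
proof -
  let ?e = "\<lambda>x :: 2. if x = 1 then vec2 1 0 else vec2 0 1"
  have s: "sform (pauli_array a b g d) x y v u =
      of_real a * (x$1 * cnj (y$1) * cnj (v$1) * u$1 + x$2 * cnj (y$2) * cnj (v$2) * u$2)
    + of_real b * (x$1 * cnj (y$1) * cnj (v$2) * u$2 + x$2 * cnj (y$2) * cnj (v$1) * u$1)
    + of_real g * (x$1 * cnj (y$2) * cnj (v$1) * u$2 + x$2 * cnj (y$1) * cnj (v$2) * u$1)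
    + of_real d * (x$1 * cnj (y$2) * cnj (v$2) * u$1 + x$2 * cnj (y$1) * cnj (v$1) * u$2)" for x y v u
    by (simp add: sform_def pauli_array_def sum_2 algebra_simps)
  let ?t = "\<lambda>v'. tform (pauli_array a b g d) (pauli_array a b g d) ?e ?e ?e v'"
  have "?t (\<lambda>y. if y = 1 then vec2 1 0 else vec2 0 (-1)) = of_real (2 * (a\<^sup>2 + b\<^sup>2 - g\<^sup>2 - d\<^sup>2))"
    by (simp add: tform_def s sum_2 power2_eq_square algebra_simps)
  then have "Re (of_real (2 * (a\<^sup>2 + b\<^sup>2 - g\<^sup>2 - d\<^sup>2))) \<ge> 0"
    using t complex_nonneg_Reals_iff by metis
  then show "a\<^sup>2 + b\<^sup>2 \<ge> g\<^sup>2 + d\<^sup>2" by simp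
  have "?t (\<lambda>y. if y = 1 then vec2 0 1 else vec2 1 0) = of_real (4 * (a * b + g * d))"
    by (simp add: tform_def s sum_2 power2_eq_square algebra_simps)
  then have "Re (of_real (4 * (a * b + g * d))) \<ge> 0"
    using t complex_nonneg_Reals_iff by metis
  then show "a * b + g * d \<ge> 0" by simp
  have "?t (\<lambda>y. if y = 1 then vec2 0 1 else vec2 (-1) 0) = of_real (4 * (a * b - g * d))"
    by (simp add: tform_def s sum_2 power2_eq_square algebra_simps)
  then have "Re (of_real (4 * (a * b - g * d))) \<ge> 0"
    using t complex_nonneg_Reals_iff by metis
  then show "a * b - g * d \<ge> 0" by simp
qed

section \<open>Decomposing the matrix of Pauli weights\<close>

text \<open>The reflection \<open>X \<mapsto> tr(X) I - X\<close> on the coefficients with respect to \<open>X \<mapsto> \<sigma>\<^sub>n X \<sigma>\<^sub>n\<close>,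
  which uses \<open>\<Sum>\<^sub>n \<sigma>\<^sub>n X \<sigma>\<^sub>n = 2 tr(X) I\<close>.\<close>

definition refl_entry :: "nat \<Rightarrow> nat \<Rightarrow> real" where
  "refl_entry a b = 1/2 - (if a = b then 1 else 0)"

lemma refl_entry_commute: "refl_entry a b = refl_entry b a"
  by (simp add: refl_entry_def eq_commute)

text \<open>Take \<open>u\<close> as large as its bounds and \<open>T\<close> permit; the four sum
  conditions then bound the remainder.\<close>

lemma split_between_bounds:
  fixes T :: real
  assumes "T \<ge> 0" "U1 \<ge> 0" "U2 \<ge> 0" "W1 \<ge> 0" "W2 \<ge> 0"
    "U1 + W1 \<ge> T" "U1 + W2 \<ge> T" "U2 + W1 \<ge> T" "U2 + W2 \<ge> T"
  obtains u w where "u \<ge> 0" "w \<ge> 0" "u \<le> U1" "u \<le> U2" "w \<le> W1" "w \<le> W2" "u + w = T"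
proof
  define u where "u = min T (min U1 U2)"
  show "u \<ge> 0" "T - u \<ge> 0" "u \<le> U1" "u \<le> U2" "T - u \<le> W1" "T - u \<le> W2" "u + (T - u) = T"
    using assms unfolding u_def by (auto simp: min_def)
qed

text \<open>Here \<open>q\<close> is negative at \<open>m\<close> and its reflection, half the total
  minus \<open>q\<close>, is negative at \<open>k\<close>, so neither yields an entrywise
  nonnegative product and both parts are needed.\<close>

lemma product_decomposition_mixed_signs:
  fixes q :: "nat \<Rightarrow> real"
  assumes idx: "distinct [k,i,j,m]" "{..<4} = {k,i,j,m}"
    and n: "q m < 0" and half: "2 * q k > q k + q i + q j + q m"
    and pos: "q k + q i + q j + q m > 0"
    and r: "q k * q i + q j * q m \<ge> 0" "q k * q j + q i * q m \<ge> 0" "q k * q m + q i * q j \<ge> 0"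
  shows "\<exists>p1 p2. \<forall>a<4. \<forall>b<4. p1 a b \<ge> 0 \<and> p2 a b \<ge> 0 \<and>
    q a * q b = p1 a b + (\<Sum>a'<4. \<Sum>b'<4. refl_entry a a' * refl_entry b b' * p2 a' b')"
proof -
  define x y z n where "x = q k" and "y = q i" and "z = q j" and "n = - q m"
  have q: "q k = x" "q i = y" "q j = z" "q m = - n" by (simp_all add: x_def y_def z_def n_def)
  have np: "n > 0" using n by (simp add: n_def)
  note r = r[unfolded q]
  have S: "x + y + z - n > 0" using pos unfolding q by simp
  have both: "s \<ge> 0" if "s * t \<ge> 0" "s + t > 0" for s t :: real
  proof (rule ccontr)
    assume "\<not> s \<ge> 0"
    then have "s < 0" "t > 0" using that(2) by simp_all
    then have "s * t < 0" by (rule mult_neg_pos)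
    then show False using that(1) by simp
  qed
  \<comment> \<open>Two of the inequalities \<open>r\<close> add up to
    \<open>(x - n) * (y + z) \<ge> 0\<close>, and these factors have the positive sum
    \<open>S\<close>. The other two pairs give \<open>yn\<close> and \<open>zn\<close>.\<close>
  have xn: "x - n \<ge> 0" by (rule both[of _ "y + z"]) (use r S in \<open>simp_all add: algebra_simps\<close>)
  have yn: "y - n \<ge> 0" by (rule both[of _ "x + z"]) (use r S in \<open>simp_all add: algebra_simps\<close>)
  have zn: "z - n \<ge> 0" by (rule both[of _ "x + y"]) (use r S in \<open>simp_all add: algebra_simps\<close>)
  have h: "x + n \<ge> y + z" using half unfolding q by simp
  have "y \<ge> 0" "z \<ge> 0" using yn zn np by simp_all
  have sq: "y\<^sup>2 - n\<^sup>2 \<ge> 0" "z\<^sup>2 - n\<^sup>2 \<ge> 0" using yn zn np by (simp_all add: power_mono)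
  \<comment> \<open>The upper bounds make \<open>p1\<close> nonnegative at \<open>(i,m)\<close>,
    \<open>(j,j)\<close>, \<open>(j,m)\<close> and \<open>(i,i)\<close>, in this order; the sum
    makes it vanish at \<open>(m,m)\<close>. The conditions for a split reduce to
    \<open>half\<close>, to the squares of \<open>y - n\<close> and \<open>z - n\<close>, and to the
    square of \<open>y - z\<close> with \<open>r(3)\<close>.\<close>
  obtain u w where uw: "u \<ge> 0" "w \<ge> 0" "u \<le> 2 * n * (x - y)" "u \<le> z\<^sup>2 - n\<^sup>2" "w \<le> 2 * n * (x - z)" "w \<le> y\<^sup>2 - n\<^sup>2"
    "u + w = 2 * n * (x - n)"
  proof (rule split_between_bounds[of "2 * n * (x - n)" "2 * n * (x - y)" "z\<^sup>2 - n\<^sup>2" "2 * n * (x - z)" "y\<^sup>2 - n\<^sup>2"])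
    show "2 * n * (x - n) \<le> 2 * n * (x - y) + 2 * n * (x - z)"
    proof -
      have "0 \<le> 2 * n * (x + n - (y + z))" using np h by simp
      then show ?thesis by (simp add: algebra_simps)
    qed
    show "2 * n * (x - n) \<le> 2 * n * (x - y) + (y\<^sup>2 - n\<^sup>2)"
      using zero_le_power2[of "y - n"] by (simp add: power2_eq_square algebra_simps)
    show "2 * n * (x - n) \<le> z\<^sup>2 - n\<^sup>2 + 2 * n * (x - z)"
      using zero_le_power2[of "z - n"] by (simp add: power2_eq_square algebra_simps)
    show "2 * n * (x - n) \<le> z\<^sup>2 - n\<^sup>2 + (y\<^sup>2 - n\<^sup>2)"
      using zero_le_power2[of "y - z"] r(3) by (simp add: power2_eq_square algebra_simps)
  qed (use np xn h yn zn sq in auto)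
  \<comment> \<open>Needed for \<open>p1\<close> at \<open>(k,i)\<close>, as \<open>k2\<close> is at
    \<open>(k,j)\<close>. After multiplication by \<open>y\<close>, the slack beyond the bound on
    \<open>w\<close> already known is visibly nonnegative.\<close>
  have k1: "w \<le> 2 * x * (y - n)"
  proof -
    have "0 \<le> x * (y - n)\<^sup>2 + n * (y * z - x * n)" using xn np r(3) by simp
    also have "\<dots> = y * (x * (y - n) - n * (x - z))" by (simp add: power2_eq_square algebra_simps)
    finally have "0 \<le> x * (y - n) - n * (x - z)" using yn np by (simp add: zero_le_mult_iff)
    then show ?thesis using uw(5) by simp
  qed
  have k2: "u \<le> 2 * x * (z - n)"
  proof -
    have "0 \<le> x * (z - n)\<^sup>2 + n * (y * z - x * n)" using xn np r(3) by simp
    also have "\<dots> = z * (x * (z - n) - n * (x - y))" by (simp add: power2_eq_square algebra_simps)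
    finally have "0 \<le> x * (z - n) - n * (x - y)" using zn np by (simp add: zero_le_mult_iff)
    then show ?thesis using uw(3) by simp
  qed
  \<comment> \<open>The only negative entries of \<open>q\<close> and of its reflection are at \<open>m\<close> and \<open>k\<close>. The ansatz makes \<open>p2\<close> and \<open>p1\<close>
      vanish at \<open>(k,m)\<close>, \<open>p2\<close> at \<open>(k,k)\<close> and \<open>p1\<close> at \<open>(m,m)\<close>; this fixes everything but \<open>u\<close>
      and \<open>w\<close>, whose sum is prescribed.\<close>
  define p2 where "p2 a b = (if a = m \<and> b = m then 4 * n * x
     else if a = i \<and> b = m \<or> a = m \<and> b = i then u else if a = j \<and> b = m \<or> a = m \<and> b = j then w else 0)" for a b
  define p1 where "p1 a b = q a * q b - (\<Sum>a'<4. \<Sum>b'<4. refl_entry a a' * refl_entry b b' * p2 a' b')" for a b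
  have neq: "k \<noteq> i" "k \<noteq> j" "k \<noteq> m" "i \<noteq> j" "i \<noteq> m" "j \<noteq> m" "i \<noteq> k" "j \<noteq> k" "m \<noteq> k" "j \<noteq> i" "m \<noteq> i" "m \<noteq> j"
    using idx(1) by auto
  have sum: "(\<Sum>a<4. f a) = f k + f i + f j + f m" for f :: "nat \<Rightarrow> real"
    unfolding idx(2) using neq by simp
  have p1: "p1 a b = q a * q b - (4 * n * x * refl_entry a m * refl_entry b m + u * (refl_entry a i * refl_entry b m + refl_entry a m * refl_entry b i)
      + w * (refl_entry a j * refl_entry b m + refl_entry a m * refl_entry b j))" for a b
    unfolding p1_def sum p2_def by (simp add: neq algebra_simps)
  have wu: "w = 2 * n * x - 2 * n * n - u" using uw(7) by (simp add: algebra_simps)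
  have "p1 a b \<ge> 0" if "a < 4" "b < 4" for a b
  proof -
    have "a \<in> {k,i,j,m}" "b \<in> {k,i,j,m}" using that idx(2) by blast+
    moreover have "p1 k k = (x - n)\<^sup>2" "p1 i i = y\<^sup>2 - n\<^sup>2 - w" "p1 j j = z\<^sup>2 - n\<^sup>2 - u" "p1 m m = 0"
      "p1 k m = 0" "p1 m k = 0" "p1 i j = x * - n + y * z" "p1 j i = x * - n + y * z"
      "p1 i m = n * (x - y) - u / 2" "p1 m i = n * (x - y) - u / 2"
      "p1 j m = n * (x - z) - w / 2" "p1 m j = n * (x - z) - w / 2"
      "p1 k i = x * (y - n) - w / 2" "p1 i k = x * (y - n) - w / 2"
      "p1 k j = x * (z - n) - u / 2" "p1 j k = x * (z - n) - u / 2"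
      unfolding p1 wu by (simp_all add: q refl_entry_def neq power2_eq_square field_simps)
    ultimately show ?thesis
      using uw k1 k2 r(3) by auto
  qed
  moreover have "p2 a b \<ge> 0" for a b
    using np xn uw by (simp add: p2_def)
  ultimately show ?thesis
    by (intro exI[of _ p1] exI[of _ p2]) (simp add: p1_def)
qed

text \<open>If all \<open>q a\<close> are nonnegative, \<open>p1\<close> alone suffices; if all
  reflected weights are, \<open>p2\<close> alone does. Otherwise there is a negative weight and
  another above half the total.\<close>

lemma product_decomposition:
  fixes q :: "nat \<Rightarrow> real"
  assumes pos: "q 0 + q 1 + q 2 + q 3 > 0"
    and r: "q 0 * q 1 + q 2 * q 3 \<ge> 0" "q 0 * q 2 + q 1 * q 3 \<ge> 0" "q 0 * q 3 + q 1 * q 2 \<ge> 0"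
  shows "\<exists>p1 p2. \<forall>a<4. \<forall>b<4. p1 a b \<ge> 0 \<and> p2 a b \<ge> 0 \<and>
    q a * q b = p1 a b + (\<Sum>a'<4. \<Sum>b'<4. refl_entry a a' * refl_entry b b' * p2 a' b')"
proof -
  define S where "S = q 0 + q 1 + q 2 + q 3"
  have four: "{..<4} = {0,1,2,3::nat}" by auto
  consider "\<forall>a<4. q a \<ge> 0" | "\<forall>a<4. q a \<le> S / 2" | m k where "m < 4" "k < 4" "q m < 0" "q k > S / 2"
    by (meson not_le)
  then show ?thesis
  proof cases
    case 1
    then show ?thesis by (intro exI[of _ "\<lambda>a b. q a * q b"] exI[of _ "\<lambda>_ _. 0"]) simp
  next
    case 2
    \<comment> \<open>The reflection is an involution sending \<open>q a\<close> to
      \<open>S / 2 - q a\<close>.\<close>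
    have "q a = (\<Sum>a'<4. refl_entry a a' * (S / 2 - q a'))" if "a < 4" for a
    proof -
      have "a \<in> {0,1,2,3}" using that four by blast
      then show ?thesis by (auto simp: sum_lt_4 refl_entry_def S_def field_simps)
    qed
    moreover define q' where "q' a = S / 2 - q a" for a
    ultimately have q': "q a = (\<Sum>a'<4. refl_entry a a' * q' a')" if "a < 4" for a
      using that by simp
    have "q a * q b = (\<Sum>a'<4. \<Sum>b'<4. refl_entry a a' * refl_entry b b' * (q' a' * q' b'))" if "a < 4" "b < 4" for a b
      unfolding q'[OF that(1)] q'[OF that(2)] sum_product by (intro sum.cong refl) (simp add: mult_ac)
    moreover have "q' a \<ge> 0" if "a < 4" for a using 2 that by (simp add: q'_def)
    ultimately show ?thesis
      by (intro exI[of _ "\<lambda>_ _. 0"] exI[of _ "\<lambda>a b. q' a * q' b"]) simp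
  next
    case 3
    have "S > 0" using pos by (simp add: S_def)
    then have "k \<noteq> m" using 3 by auto
    then have "card ({..<4} - {k,m}) = 2" using 3 by (simp add: card_Diff_subset)
    then obtain i j where ij': "{..<4} - {k,m} = {i,j}" "i \<noteq> j" by (auto simp: card_2_iff)
    then have ij: "distinct [k,i,j,m]" "{..<4} = {k,i,j,m}" using 3 \<open>k \<noteq> m\<close> by auto
    have r': "q a * q b + q c * q d \<ge> 0" if "distinct [a,b,c,d]" "{a,b,c,d} \<subseteq> {0,1,2,3}" for a b c d
    proof -
      have "a = 0 \<or> a = 1 \<or> a = 2 \<or> a = 3" "b = 0 \<or> b = 1 \<or> b = 2 \<or> b = 3"
        "c = 0 \<or> c = 1 \<or> c = 2 \<or> c = 3" "d = 0 \<or> d = 1 \<or> d = 2 \<or> d = 3"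
        using that(2) by auto
      then show ?thesis using that(1) r by (elim disjE) (simp_all add: mult_ac add_ac)
    qed
    have r': "q k * q i + q j * q m \<ge> 0" "q k * q j + q i * q m \<ge> 0" "q k * q m + q i * q j \<ge> 0"
      by (rule r'; use ij four in auto)+
    have "S = sum q {..<4}" by (simp add: S_def sum_lt_4)
    then have S: "S = q k + q i + q j + q m" unfolding ij(2) using ij(1) by simp
    show ?thesis
      by (rule product_decomposition_mixed_signs[OF ij 3(3) _ _ r']) (use 3(4) S \<open>S > 0\<close> in auto)
  qed
qed

section \<open>Assembling the Kraus operators\<close>

definition pauli :: "nat \<Rightarrow> complex^2^2" where
  "pauli a = (if a = 0 then mat2 1 0 0 1 else if a = 1 then mat2 1 0 0 (-1)
     else if a = 2 then mat2 0 1 1 0 else mat2 0 (-\<i>) \<i> 0)"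

definition ip :: "complex^2 \<Rightarrow> complex^2 \<Rightarrow> complex" where
  "ip v w = cnj (v$1) * w$1 + cnj (v$2) * w$2"

definition ep :: "complex^2 \<Rightarrow> complex^2 \<Rightarrow> complex" where
  "ep v w = v$1 * w$2 - v$2 * w$1"

lemma pauli_array_form:
  "bq (pauli_array a b g d) w v =
     of_real ((a + g) / 2) * (ip v (pauli 0 *v w) * cnj (ip v (pauli 0 *v w)))
   + of_real ((a - g) / 2) * (ip v (pauli 1 *v w) * cnj (ip v (pauli 1 *v w)))
   + of_real ((b + d) / 2) * (ip v (pauli 2 *v w) * cnj (ip v (pauli 2 *v w)))
   + of_real ((b - d) / 2) * (ip v (pauli 3 *v w) * cnj (ip v (pauli 3 *v w)))"
  by (simp add: sform_def pauli_array_def sum_2 ip_def pauli_def mat2_mult_vec field_simps)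

text \<open>Lagrange's identity \<open>|v|\<^sup>2 |u|\<^sup>2 - |\<langle>v, u\<rangle>|\<^sup>2 = |v\<^sub>1 u\<^sub>2 - v\<^sub>2 u\<^sub>1|\<^sup>2\<close> with \<open>u = \<sigma>\<^sub>a w\<close>. As \<open>ep\<close> is linear
  in \<open>v\<close>, the left-hand side belongs to a Kraus term followed by the transposition.\<close>

lemma pauli_reflection:
  assumes "a < 4"
  shows "ep v (pauli a *v w) * cnj (ep v (pauli a *v w)) =
    (\<Sum>b<4. of_real (refl_entry a b) * (ip v (pauli b *v w) * cnj (ip v (pauli b *v w))))"
proof -
  have "a = 0 \<or> a = 1 \<or> a = 2 \<or> a = 3" using assms by auto
  then show ?thesis
    by (elim disjE) (simp_all add: sum_lt_4 refl_entry_def ip_def ep_def pauli_def mat2_mult_vec field_simps)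
qed

text \<open>The 16 operators of each kind are indexed by pairs of Pauli indices, the pair
  \<open>a\<close>, \<open>b\<close> being stored as \<open>a * 4 + b\<close>. Products of the
  \<open>ip\<close> operators carry \<open>p1\<close>, those of the \<open>ep\<close> operators
  carry \<open>p2\<close>.\<close>

lemma tensor_kraus_decomposition_strict:
  assumes e: "e > 0" and pos: "\<And>w v. bq c w v \<in> \<real>\<^sub>\<ge>\<^sub>0"
    and strict: "\<And>w v. Re (bq c w v) \<ge> e * ((norm w)\<^sup>2 * (norm v)\<^sup>2)"
    and tpos: "\<And>w w' v v'. tform c c w w' v v' \<in> \<real>\<^sub>\<ge>\<^sub>0"
  shows "kraus_decomposition 4 16 (tens c)"
proof -
  obtain A B a b g d where AB: "det A = 1" "det B = 1" and ab: "a > 0" "b > 0"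
    and N: "transf c A B = pauli_array a b g d"
    using pauli_normal_form[OF e pos strict] by metis
  have "tform (pauli_array a b g d) (pauli_array a b g d) w w' v v' \<in> \<real>\<^sub>\<ge>\<^sub>0" for w w' v v'
    unfolding N[symmetric] tform_transf by (rule tpos)
  note cond = pauli_array_tensor_conditions[OF this]
  define q :: "nat \<Rightarrow> real" where "q n = (if n = 0 then (a + g) / 2 else if n = 1 then (a - g) / 2
    else if n = 2 then (b + d) / 2 else (b - d) / 2)" for n
  have "\<exists>p1 p2. \<forall>a<4. \<forall>b<4. p1 a b \<ge> 0 \<and> p2 a b \<ge> 0 \<and>
    q a * q b = p1 a b + (\<Sum>a'<4. \<Sum>b'<4. refl_entry a a' * refl_entry b b' * p2 a' b')"
    by (rule product_decomposition) (use ab cond in \<open>simp_all add: q_def field_simps power2_eq_square\<close>)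
  then obtain p1 p2 where p: "\<And>a b. a < 4 \<Longrightarrow> b < 4 \<Longrightarrow> p1 a b \<ge> 0" "\<And>a b. a < 4 \<Longrightarrow> b < 4 \<Longrightarrow> p2 a b \<ge> 0"
    "\<And>a b. a < 4 \<Longrightarrow> b < 4 \<Longrightarrow> q a * q b = p1 a b + (\<Sum>a'<4. \<Sum>b'<4. refl_entry a a' * refl_entry b b' * p2 a' b')"
    by blast
  \<comment> \<open>The inverses transport the Pauli decomposition back to the original
    array.\<close>
  obtain A' B' where inv: "A ** A' = mat 1" "B ** B' = mat 1"
    using AB by (metis invertible_def invertible_det_nz zero_neq_one)
  define K where "K n k i = ip (A' *v axis k 1) (pauli n *v (B' *v axis i 1))" for n k i
  define L where "L n k i = ep (A' *v axis k 1) (pauli n *v (B' *v axis i 1))" for n k i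
  define \<kappa> where "\<kappa> n i j k l = K n k i * cnj (K n l j)" for n i j k l
  define \<mu> where "\<mu> n i j k l = L n l i * cnj (L n k j)" for n i j k l
  have expand: "M *v x = x$1 *s (M *v axis 1 1) + x$2 *s (M *v axis 2 1)" for M :: "complex^2^2" and x
    by (simp add: vec_eq_iff matrix_vector_mult_def sum_2 axis_def algebra_simps)
  have K: "ip (A' *v v) (pauli n *v (B' *v w)) = (\<Sum>k\<in>UNIV. \<Sum>i\<in>UNIV. cnj (v$k) * K n k i * w$i)" for n v w
    unfolding K_def expand[of A' v] expand[of B' w]
    by (simp add: ip_def sum_2 matrix_vector_mult_2[of "pauli n"] algebra_simps)
  have L: "ep (A' *v v) (pauli n *v (B' *v w)) = (\<Sum>k\<in>UNIV. \<Sum>i\<in>UNIV. v$k * L n k i * w$i)" for n v w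
    unfolding L_def expand[of A' v] expand[of B' w]
    by (simp add: ep_def sum_2 matrix_vector_mult_2[of "pauli n"] algebra_simps)
  have bq\<kappa>: "bq (\<kappa> n) w v = ip (A' *v v) (pauli n *v (B' *v w)) * cnj (ip (A' *v v) (pauli n *v (B' *v w)))" for n w v
    unfolding K by (simp add: sform_def \<kappa>_def sum_2 algebra_simps)
  have bq\<mu>: "bq (\<mu> n) w v = ep (A' *v v) (pauli n *v (B' *v w)) * cnj (ep (A' *v v) (pauli n *v (B' *v w)))" for n w v
    unfolding L by (simp add: sform_def \<mu>_def sum_2 algebra_simps)
  have bq_sum: "bq (\<lambda>i j k l. \<Sum>n<4. of_real (r n) * \<kappa> n i j k l) w v = (\<Sum>n<4. of_real (r n) * bq (\<kappa> n) w v)" for r w v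
    by (simp add: sum_lt_4 sform_def sum.distrib sum_distrib_left algebra_simps)
  have c: "c = (\<lambda>i j k l. \<Sum>n<4. of_real (q n) * \<kappa> n i j k l)"
  proof (rule bq_eqI)
    fix w v
    have "bq c w v = bq (transf c A B) (B' *v w) (A' *v v)"
      by (simp add: sform_transf matrix_vector_mul_assoc inv)
    then show "bq c w v = bq (\<lambda>i j k l. \<Sum>n<4. of_real (q n) * \<kappa> n i j k l) w v"
      unfolding bq_sum bq\<kappa> N pauli_array_form by (simp add: sum_lt_4 q_def)
  qed
  \<comment> \<open>The transposed terms are the reflected Pauli terms, so their products weighted
    by \<open>p2\<close> contribute the reflected matrix to the coefficients of the products of the
    \<kappa>.\<close>
  have \<mu>: "\<mu> n = (\<lambda>i j k l. \<Sum>n'<4. of_real (refl_entry n n') * \<kappa> n' i j k l)" if "n < 4" for n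
    by (rule bq_eqI) (unfold bq_sum bq\<kappa> bq\<mu>, rule pauli_reflection[OF that])
  \<comment> \<open>Nonnegativity of the weights allows their square roots to be absorbed into the
    operators.\<close>
  define KK where "KK \<kappa> r p = of_real (sqrt (p1 (\<kappa> div 4) (\<kappa> mod 4))) * K (\<kappa> div 4) (hi r) (hi p) * K (\<kappa> mod 4) (lo r) (lo p)" for \<kappa> r p
  define LL where "LL \<kappa> r p = of_real (sqrt (p2 (\<kappa> div 4) (\<kappa> mod 4))) * L (\<kappa> div 4) (hi r) (hi p) * L (\<kappa> mod 4) (lo r) (lo p)" for \<kappa> r p
  have KL: "tens c p q' r s = (\<Sum>\<kappa><16. KK \<kappa> r p * cnj (KK \<kappa> s q') + LL \<kappa> s p * cnj (LL \<kappa> r q'))" for p q' r s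
  proof -
    let ?\<kappa> = "\<lambda>n. \<kappa> n (hi p) (hi q') (hi r) (hi s)" and ?\<kappa>' = "\<lambda>n. \<kappa> n (lo p) (lo q') (lo r) (lo s)"
    let ?\<mu> = "\<lambda>n. \<mu> n (hi p) (hi q') (hi r) (hi s)" and ?\<mu>' = "\<lambda>n. \<mu> n (lo p) (lo q') (lo r) (lo s)"
    have sq: "of_real (sqrt x) * of_real (sqrt x) = (of_real x :: complex)" if "x \<ge> 0" for x
      using that by (simp flip: of_real_mult)
    have "(\<Sum>\<kappa><16. KK \<kappa> r p * cnj (KK \<kappa> s q') + LL \<kappa> s p * cnj (LL \<kappa> r q'))
      = (\<Sum>a<4. \<Sum>b<4. KK (a*4+b) r p * cnj (KK (a*4+b) s q') + LL (a*4+b) s p * cnj (LL (a*4+b) r q'))"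
      using sum_mult_nat[of "\<lambda>\<kappa>. KK \<kappa> r p * cnj (KK \<kappa> s q') + LL \<kappa> s p * cnj (LL \<kappa> r q')" 4 4] by simp
    also have "\<dots> = (\<Sum>a<4. \<Sum>b<4. of_real (p1 a b) * (?\<kappa> a * ?\<kappa>' b) + of_real (p2 a b) * (?\<mu> a * ?\<mu>' b))"
    proof (intro sum.cong refl)
      fix a b :: nat assume "a \<in> {..<4}" "b \<in> {..<4}"
      then have ab: "a < 4" "b < 4" by auto
      have "KK (a*4+b) r p * cnj (KK (a*4+b) s q') + LL (a*4+b) s p * cnj (LL (a*4+b) r q')
        = (of_real (sqrt (p1 a b)) * of_real (sqrt (p1 a b))) * (?\<kappa> a * ?\<kappa>' b)
        + (of_real (sqrt (p2 a b)) * of_real (sqrt (p2 a b))) * (?\<mu> a * ?\<mu>' b)"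
        using ab by (simp add: KK_def LL_def \<kappa>_def \<mu>_def mult_ac)
      then show "KK (a*4+b) r p * cnj (KK (a*4+b) s q') + LL (a*4+b) s p * cnj (LL (a*4+b) r q')
        = of_real (p1 a b) * (?\<kappa> a * ?\<kappa>' b) + of_real (p2 a b) * (?\<mu> a * ?\<mu>' b)"
        unfolding sq[OF p(1)[OF ab]] sq[OF p(2)[OF ab]] .
    qed
    also have "\<dots> = (\<Sum>a<4. \<Sum>b<4. of_real (p1 a b) * (?\<kappa> a * ?\<kappa>' b)) + (\<Sum>a'<4. \<Sum>b'<4. of_real (p2 a' b') * (?\<mu> a' * ?\<mu>' b'))"
      by (simp add: sum.distrib)
    also have "(\<Sum>a'<4. \<Sum>b'<4. of_real (p2 a' b') * (?\<mu> a' * ?\<mu>' b'))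
      = (\<Sum>a'<4. \<Sum>b'<4. \<Sum>a<4. \<Sum>b<4. of_real (refl_entry a a' * refl_entry b b' * p2 a' b') * (?\<kappa> a * ?\<kappa>' b))"
    proof (intro sum.cong refl)
      fix a' b' :: nat assume "a' \<in> {..<4}" "b' \<in> {..<4}"
      then have "?\<mu> a' * ?\<mu>' b' = (\<Sum>a<4. \<Sum>b<4. (of_real (refl_entry a' a) * ?\<kappa> a) * (of_real (refl_entry b' b) * ?\<kappa>' b))"
        by (simp add: \<mu> sum_product)
      then show "of_real (p2 a' b') * (?\<mu> a' * ?\<mu>' b') = (\<Sum>a<4. \<Sum>b<4. of_real (refl_entry a a' * refl_entry b b' * p2 a' b') * (?\<kappa> a * ?\<kappa>' b))"
        by (simp add: sum_distrib_left refl_entry_commute mult_ac)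
    qed
    also have "\<dots> = (\<Sum>a<4. \<Sum>b<4. \<Sum>a'<4. \<Sum>b'<4. of_real (refl_entry a a' * refl_entry b b' * p2 a' b') * (?\<kappa> a * ?\<kappa>' b))"
      by (subst sum_swap3) (intro sum.cong[OF refl] sum_swap3)
    also have "(\<Sum>a<4. \<Sum>b<4. of_real (p1 a b) * (?\<kappa> a * ?\<kappa>' b)) + \<dots> = (\<Sum>a<4. \<Sum>b<4. of_real (q a * q b) * (?\<kappa> a * ?\<kappa>' b))"
      unfolding sum.distrib[symmetric]
      by (intro sum.cong refl) (simp only: p(3) lessThan_iff of_real_add of_real_sum sum_distrib_right distrib_right)
    also have "\<dots> = tens c p q' r s"
      unfolding tens_def by (subst (1 2) c) (simp add: sum_product mult_ac)
    finally show ?thesis ..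
  qed
  show ?thesis unfolding kraus_decomposition_def
    by (intro exI[of _ KK] exI[of _ LL] allI impI) (rule KL)
qed

theorem theorem1:
  fixes P :: "complex mat \<Rightarrow> complex mat"
  assumes "lin_map 2 2 P"
  shows "positive_map 4 4 (tensor_map 2 2 2 2 P P) \<longleftrightarrow> decomposable 4 4 (tensor_map 2 2 2 2 P P)"
proof
  assume pos: "positive_map 4 4 (tensor_map 2 2 2 2 P P)"
  have "tform (map_coeff P) (map_coeff P) w w' v v' \<in> \<real>\<^sub>\<ge>\<^sub>0" for w w' v v'
    using tform_nonneg[OF assms pos] by (simp add: complex_nonneg_Reals_iff)
  with tensor_kraus_decomposition_strict have "kraus_decomposition 4 16 (tens (map_coeff P))"
    by (rule tensor_decomposable_if_strict)
  then show "decomposable 4 4 (tensor_map 2 2 2 2 P P)"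
    by (rule kraus_decomposition_imp_decomposable_tensor[OF assms])
qed (rule decomposable_imp_positive)

end
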